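(* Let $m\ge n$, let $A\in\mathbb{C}^{m\times n}$, and suppose that for some $k>0$ $$A=(X_1\quad X_2)\begin{pmatrix}A_{11}&A_{12}\\ A_{21}&A_{22}\end{pmatrix}\begin{pmatrix}Y_1^{*}\\ Y_2^{*}\end{pmatrix},$$ where $X=(X_1\ X_2)\in\mathbb{C}^{m\times m}$ and $Y=(Y_1\ Y_2)\in\mathbb{C}^{n\times n}$ are unitary, $X_1$ and $Y_1$ each have $k$ columns, and $A_{11}$ is $k\times k$. Let $$\varepsilon_k=\left\|\begin{pmatrix}0&A_{12}\\ A_{21}&A_{22}\end{pmatrix}\right\|.$$ Assume $X_1$ is $\mu$-coherent (no coherence assumption is made on $Y_1$). Let $\ell\ge10\mu k\log m$. Then, with probability at least $1-2km^{-2}$, Algorithm 3 (described in the context) with input $A$ returns a skeleton $A_{:C'}ZA_{R:}$, with $\ell$ rows and $k$ columns of $A$, that satisfies $$\|A-A_{:C'}ZA_{R:}\|=O\left(\varepsilon_k(mn)^{1/2}\right).$$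
   Context: $\|\cdot\|$ is the spectral norm ($2$-norm), $^{*}$ is conjugate transpose, $^{+}$ is the Moore-Penrose pseudoinverse, $\log$ is the natural logarithm, $\sigma_j(\cdot)$ is the $j$-th largest singular value. The constant implied by $O(\cdot)$ is absolute. Coherence: a matrix $X\in\mathbb{C}^{n\times k}$ with $k$ orthonormal columns is $\mu$-coherent if $\max_{ij}|X_{ij}|\le(\mu/n)^{1/2}$ (here $n$ is the number of rows of $X$). Restrictions: $A_{:C}$ is the restriction of $A$ to the columns indexed by $C$, $A_{R:}$ the restriction to the rows indexed by $R$, and $A_{RC}$ the restriction to rows $R$ and columns $C$ (repeated indices, if any, give repeated rows or columns). RRQR means the strong rank-revealing QR factorization of Gu and Eisenstat: applied to a matrix $M$ with $q$ columns, it selects $k$ columns of $M$, forming a matrix $M'$, such that $D=M'^{+}M$ satisfies $\|M-M'D\|\le\sqrt{1+2k(q-k)}\,\sigma_{k+1}(M)$ and $\|D\|\le\sqrt{1+2k(q-k)}$. Algorithm 3 (input $A\in\mathbb{C}^{m\times n}$): (1) Uniformly and independently select $\ell$ row indices $R$ to form $A_{R:}$. (2) Run RRQR on $A_{R:}$ to select $k$ of its columns, with index set $C'$, obtaining $A_{R:}\simeq A_{RC'}(A_{RC'}^{+}A_{R:})$. (3) Compute $Z=A_{RC'}^{+}$. (4) Output $A_{:C'}ZA_{R:}$. The probability is over the random choice of $R$. *)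

theory Defs
  imports "HOL-Probability.Probability" "Jordan_Normal_Form.Schur_Decomposition"
begin

text \<open>
  Matrices are those of Jordan_Normal_Form, since all dimensions are universally
  quantified inside the scope of the absolute constant. Indices start at 0.
\<close>

definition append_cols :: "complex mat \<Rightarrow> complex mat \<Rightarrow> complex mat"  (infixr \<open>@\<^sub>c\<close> 65) where
  "A @\<^sub>c B = four_block_mat A B (0\<^sub>m 0 (dim_col A)) (0\<^sub>m 0 (dim_col B))"

definition unitary_mat :: "nat \<Rightarrow> complex mat \<Rightarrow> bool" where
  "unitary_mat n U \<longleftrightarrow>
     U \<in> carrier_mat n n \<and> mat_adjoint U * U = 1\<^sub>m n \<and> U * mat_adjoint U = 1\<^sub>m n"

definition l2_norm_vec :: "complex Matrix.vec \<Rightarrow> real" where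
  "l2_norm_vec v = L2_set (\<lambda>i. cmod (vec_index v i)) {..<dim_vec v}"

definition spectral_norm :: "complex mat \<Rightarrow> real" where
  "spectral_norm M =
     Sup {l2_norm_vec (M *\<^sub>v v) |v. v \<in> carrier_vec (dim_col M) \<and> l2_norm_vec v \<le> 1}"

text \<open>
  Singular values are the square roots of the eigenvalues of \<open>M\<^sup>* M\<close>, counted with algebraic
  multiplicity and listed in decreasing order. These eigenvalues are real and nonnegative, so
  taking \<open>Re\<close> is only a change of type.
\<close>

definition singular_values :: "complex mat \<Rightarrow> real list" where
  "singular_values M = rev (sorted_list_of_multiset
     (image_mset (\<lambda>z. sqrt (Re z)) (proots (char_poly (mat_adjoint M * M)))))"

text \<open>
  The \<open>j\<close>-th largest singular value, with \<open>j \<ge> 1\<close>; it is \<open>0\<close> for \<open>j\<close> beyond the number of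
  singular values, as usual.
\<close>

definition sing_val :: "nat \<Rightarrow> complex mat \<Rightarrow> real" where
  "sing_val j M =
     (if 1 \<le> j \<and> j \<le> length (singular_values M) then singular_values M ! (j - 1) else 0)"

definition is_pinv :: "complex mat \<Rightarrow> complex mat \<Rightarrow> bool" where
  "is_pinv M Z \<longleftrightarrow>
     Z \<in> carrier_mat (dim_col M) (dim_row M) \<and>
     M * Z * M = M \<and> Z * M * Z = Z \<and>
     mat_adjoint (M * Z) = M * Z \<and> mat_adjoint (Z * M) = Z * M"

definition pinv :: "complex mat \<Rightarrow> complex mat" where
  "pinv M = (THE Z. is_pinv M Z)"

definition coherent :: "real \<Rightarrow> complex mat \<Rightarrow> bool" where
  "coherent \<mu> X \<longleftrightarrow>
     mat_adjoint X * X = 1\<^sub>m (dim_col X) \<and>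
     (\<forall>i < dim_row X. \<forall>j < dim_col X. cmod (X $$ (i, j)) \<le> sqrt (\<mu> / real (dim_row X)))"

text \<open>Index sets are lists, so that repeated indices give repeated rows or columns.\<close>

definition restrict_rows :: "complex mat \<Rightarrow> nat list \<Rightarrow> complex mat" where
  "restrict_rows A R = Matrix.mat (length R) (dim_col A) (\<lambda>(i, j). A $$ (R ! i, j))"

definition restrict_cols :: "complex mat \<Rightarrow> nat list \<Rightarrow> complex mat" where
  "restrict_cols A C = Matrix.mat (dim_row A) (length C) (\<lambda>(i, j). A $$ (i, C ! j))"

definition col_selection :: "nat \<Rightarrow> nat \<Rightarrow> nat list \<Rightarrow> bool" where
  "col_selection k q C \<longleftrightarrow> length C = k \<and> distinct C \<and> set C \<subseteq> {..<q}"

definition rrqr_cols :: "nat \<Rightarrow> complex mat \<Rightarrow> nat list \<Rightarrow> bool" where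
  "rrqr_cols k M C \<longleftrightarrow>
     (let q = dim_col M; M' = restrict_cols M C; D = pinv M' * M;
          c = sqrt (1 + 2 * real k * (real q - real k))
      in col_selection k q C \<and>
         spectral_norm (M - M' * D) \<le> c * sing_val (k + 1) M \<and>
         spectral_norm D \<le> c)"

text \<open>
  RRQR enters only through its guarantee: a procedure is a function from matrices to
  selected columns whose result always has the guaranteed properties. There is no
  restriction on the number of rows or the rank of \<open>M\<close>: such a procedure exists in general,
  by applying the Gu-Eisenstat result to \<open>M\<close> with \<open>\<epsilon>I\<close> appended below it and letting \<open>\<epsilon>\<close> tend
  to \<open>0\<close> along a subsequence with constant column selection.
\<close>

definition strong_rrqr :: "nat \<Rightarrow> (complex mat \<Rightarrow> nat list) \<Rightarrow> bool" where
  "strong_rrqr k rrqr \<longleftrightarrow> (\<forall>M. k \<le> dim_col M \<longrightarrow> rrqr_cols k M (rrqr M))"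

text \<open>
  The output \<open>(C', Z, R)\<close> stands for the skeleton, whose value as a matrix is
  \<open>skeleton A C' Z R\<close>. The rows \<open>R\<close> are sampled with replacement.
\<close>

definition algorithm3 ::
  "(complex mat \<Rightarrow> nat list) \<Rightarrow> nat \<Rightarrow> complex mat \<Rightarrow> (nat list \<times> complex mat \<times> nat list) pmf" where
  "algorithm3 rrqr l A =
     map_pmf (\<lambda>R. let A\<^sub>R = restrict_rows A R;
                      C' = rrqr A\<^sub>R;
                      Z = pinv (restrict_cols A\<^sub>R C')
                  in (C', Z, R))
       (replicate_pmf l (pmf_of_set {..<dim_row A}))"

definition skeleton :: "complex mat \<Rightarrow> nat list \<Rightarrow> complex mat \<Rightarrow> nat list \<Rightarrow> complex mat" where
  "skeleton A C Z R = restrict_cols A C * Z * restrict_rows A R"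

end

theory Submission
  imports Defs
begin

text \<open>
  Write \<open>A = X\<^sub>1 T + F\<close> with \<open>T = A\<^sub>1\<^sub>1 Y\<^sub>1\<^sup>*\<close> and \<open>\<parallel>F\<parallel> \<le> \<epsilon>\<^sub>k\<close>. Up to \<open>\<epsilon>\<^sub>k\<close>, a vector \<open>A w\<close> is determined by
  the \<open>k\<close> numbers \<open>T w\<close>, and these can be recovered from the sampled entries of \<open>X\<^sub>1 T w\<close> as soon as
  the sampled rows of \<open>X\<^sub>1\<close> form a well conditioned matrix. The column selection controls
  the error of the skeleton on the sampled rows, and this recovery spreads the control to all rows
  (\<open>skeleton_error\<close>). Two facts about the sample are needed.

  First, \<open>\<parallel>(X\<^sub>1 u)\<^sub>R\<parallel>\<^sup>2 \<ge> (l / (10 m)) \<parallel>u\<parallel>\<^sup>2\<close> for all \<open>u\<close>. This is a lower tail bound for a sum of \<open>l\<close>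
  independent rank-one matrices (\<open>row_sampling_lower_tail\<close>), whose size is limited by
  coherence. It is proved by bounding \<open>E tr (Q\<^sub>1 + \<dots> + Q\<^sub>l) ^ p\<close> for independent contractions
  \<open>0 \<le> Q\<^sub>i \<le> I\<close> with mean \<open>q I\<close>. Expanding the power into words in the \<open>Q\<^sub>i\<close>, every letter that
  occurs exactly once averages to the scalar \<open>q\<close>, and what is left is a product of contractions;
  so a word contributes at most \<open>k q ^ s\<close>, where \<open>s\<close> is the number of its letters that occur once
  (\<open>expectation_apply_word\<close>). Exponential generating functions count the words
  (\<open>singleton_weight_sums\<close>), and Markov's inequality gives \<open>large_total_bound\<close>. This argument
  takes the place of the Golden-Thompson or Lieb inequality in the usual matrix Chernoff bounds.

  Second, no row is drawn more than \<open>3 l / k\<close> times (\<open>multiplicity_tail\<close>). Rows are drawn with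
  replacement, so passing to the sampled rows may enlarge norms by the square root of the largest
  multiplicity. With that bound \<open>\<sigma>\<^sub>k\<^sub>+\<^sub>1 (A\<^sub>R) \<le> \<surd>(3 l / k) \<epsilon>\<^sub>k\<close> by \<open>sing_val_le\<close>, and the factors
  \<open>\<surd>(l / k)\<close>, \<open>\<surd>(m / l)\<close> and the \<open>\<surd>(k n)\<close> of the column selection multiply to \<open>\<surd>(m n)\<close>.

  Diagonalization of hermitian matrices (\<open>hermitian_diagonalization\<close>) underlies the trace
  inequality, the estimate of singular values, and the existence of the pseudoinverse; the latter
  is what makes the output \<open>Z\<close> of the algorithm a matrix of the right shape.
\<close>

(* The infix $ is indexing of vectors whose dimension is a term. *)
unbundle no vec_syntax

section \<open>Vector norms, adjoints and the spectral norm\<close>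

lemma mat_adjoint_dim [simp]:
  "dim_row (mat_adjoint A) = dim_col A" "dim_col (mat_adjoint A) = dim_row A"
  by (simp_all add: mat_adjoint_def)

lemma mat_adjoint_carrier [simp]:
  "A \<in> carrier_mat m n \<Longrightarrow> mat_adjoint A \<in> carrier_mat n m"
  by (rule carrier_matI) simp_all

lemma mat_adjoint_index [simp]:
  "i < dim_col A \<Longrightarrow> j < dim_row A \<Longrightarrow> mat_adjoint A $$ (i, j) = conjugate (A $$ (j, i))"
  by (simp add: mat_adjoint_def mat_of_rows_def)

lemma mat_adjoint_adjoint [simp]: "mat_adjoint (mat_adjoint (A :: complex mat)) = A"
  by (rule eq_matI) auto

lemma mat_adjoint_one [simp]: "mat_adjoint (1\<^sub>m n :: complex mat) = 1\<^sub>m n"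
  by (rule eq_matI) auto

lemma mat_adjoint_mult:
  assumes "(A :: complex mat) \<in> carrier_mat m n" "B \<in> carrier_mat n p"
  shows "mat_adjoint (A * B) = mat_adjoint B * mat_adjoint A"
proof (rule eq_matI)
  fix i j assume "i < dim_row (mat_adjoint B * mat_adjoint A)"
    "j < dim_col (mat_adjoint B * mat_adjoint A)"
  hence ij: "i < p" "j < m" using assms by auto
  have "mat_adjoint (A * B) $$ (i, j) = cnj (\<Sum>t<n. A $$ (j, t) * B $$ (t, i))"
    using ij assms by (simp add: scalar_prod_def atLeast0LessThan)
  also have "\<dots> = (\<Sum>t<n. cnj (B $$ (t, i)) * cnj (A $$ (j, t)))"
    by (simp add: mult.commute)
  also have "\<dots> = (mat_adjoint B * mat_adjoint A) $$ (i, j)"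
    using ij assms by (simp add: scalar_prod_def atLeast0LessThan)
  finally show "mat_adjoint (A * B) $$ (i, j) = (mat_adjoint B * mat_adjoint A) $$ (i, j)" .
qed (use assms in auto)

lemma adjoint_cscalar_prod:
  assumes "(A :: complex mat) \<in> carrier_mat m n" "u \<in> carrier_vec n" "v \<in> carrier_vec m"
  shows "(A *\<^sub>v u) \<bullet>c v = u \<bullet>c (mat_adjoint A *\<^sub>v v)"
proof -
  have "(A *\<^sub>v u) \<bullet>c v = (\<Sum>i<m. \<Sum>j<n. A $$ (i,j) * u $ j * cnj (v $ i))"
    using assms by (auto simp: scalar_prod_def sum_distrib_right atLeast0LessThan)
  also have "\<dots> = (\<Sum>j<n. \<Sum>i<m. A $$ (i,j) * u $ j * cnj (v $ i))"
    by (rule sum.swap)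
  also have "\<dots> = u \<bullet>c (mat_adjoint A *\<^sub>v v)"
    using assms by (auto simp: scalar_prod_def sum_distrib_left atLeast0LessThan algebra_simps
        intro!: sum.cong)
  finally show ?thesis .
qed

lemma l2_norm_vec_nonneg [simp]: "0 \<le> l2_norm_vec v"
  by (simp add: l2_norm_vec_def)

lemma l2_norm_vec_sq: "v \<in> carrier_vec n \<Longrightarrow> (l2_norm_vec v)\<^sup>2 = (\<Sum>i<n. (cmod (v $ i))\<^sup>2)"
  by (auto simp: l2_norm_vec_def L2_set_def sum_nonneg)

lemma cscalar_prod_self: "v \<bullet>c v = of_real ((l2_norm_vec v)\<^sup>2)"
proof -
  have "v \<bullet>c v = (\<Sum>i<dim_vec v. v $ i * cnj (v $ i))"
    by (simp add: scalar_prod_def atLeast0LessThan)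
  also have "\<dots> = of_real (\<Sum>i<dim_vec v. (cmod (v $ i))\<^sup>2)"
    by (simp add: complex_norm_square del: of_real_power)
  finally show ?thesis
    by (subst l2_norm_vec_sq[where n = "dim_vec v"]) auto
qed

lemma l2_norm_vec_zero [simp]: "l2_norm_vec (0\<^sub>v n) = 0"
  by (simp add: l2_norm_vec_def L2_set_def)

lemma l2_norm_vec_eq_0: "v \<in> carrier_vec n \<Longrightarrow> l2_norm_vec v = 0 \<longleftrightarrow> v = 0\<^sub>v n"
proof
  assume v: "v \<in> carrier_vec n" and "l2_norm_vec v = 0"
  hence "\<forall>i<n. v $ i = 0" by (simp add: l2_norm_vec_def L2_set_eq_0_iff)
  thus "v = 0\<^sub>v n" using v by (intro eq_vecI) auto
qed simp

lemma l2_norm_vec_unit [simp]: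
  assumes "j < n"
  shows "l2_norm_vec (unit_vec n j) = 1"
proof -
  have "(l2_norm_vec (unit_vec n j))\<^sup>2 = (\<Sum>i<n. if i = j then 1 else 0)"
    unfolding l2_norm_vec_sq[OF unit_vec_carrier] using assms
    by (intro sum.cong refl) simp
  also have "\<dots> = 1\<^sup>2"
    using assms by simp
  finally show ?thesis
    by (rule power2_eq_imp_eq) auto
qed

lemma l2_norm_vec_smult: "l2_norm_vec (c \<cdot>\<^sub>v v) = cmod c * l2_norm_vec v"
proof -
  have "l2_norm_vec (c \<cdot>\<^sub>v v) = L2_set (\<lambda>i. cmod c * cmod (v $ i)) {..<dim_vec v}"
    unfolding l2_norm_vec_def by (auto simp: norm_mult intro!: L2_set_cong)
  also have "\<dots> = cmod c * l2_norm_vec v"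
    unfolding l2_norm_vec_def by (subst L2_set_right_distrib) auto
  finally show ?thesis .
qed

lemma l2_norm_vec_add:
  assumes "u \<in> carrier_vec n" "v \<in> carrier_vec n"
  shows "l2_norm_vec (u + v) \<le> l2_norm_vec u + l2_norm_vec v"
proof -
  have "l2_norm_vec (u + v) \<le> L2_set (\<lambda>i. cmod (u $ i) + cmod (v $ i)) {..<n}"
    unfolding l2_norm_vec_def using assms by (auto intro!: L2_set_mono norm_triangle_ineq)
  also have "\<dots> \<le> l2_norm_vec u + l2_norm_vec v"
    unfolding l2_norm_vec_def using assms L2_set_triangle_ineq by auto
  finally show ?thesis .
qed

lemma l2_norm_vec_diff:
  assumes "u \<in> carrier_vec n" "v \<in> carrier_vec n"
  shows "l2_norm_vec (u - v) \<le> l2_norm_vec u + l2_norm_vec v"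
proof -
  have "u - v = u + (-1) \<cdot>\<^sub>v v" using assms by auto
  thus ?thesis using l2_norm_vec_add[of u n "(-1) \<cdot>\<^sub>v v"] assms by (simp add: l2_norm_vec_smult)
qed

lemma cscalar_prod_bound:
  assumes "u \<in> carrier_vec n" "v \<in> carrier_vec n"
  shows "cmod (u \<bullet>c v) \<le> l2_norm_vec u * l2_norm_vec v"
proof -
  have "cmod (u \<bullet>c v) \<le> (\<Sum>i<n. \<bar>cmod (u $ i)\<bar> * \<bar>cmod (v $ i)\<bar>)"
    using assms by (auto simp: scalar_prod_def atLeast0LessThan norm_mult intro!: sum_norm_le)
  also have "\<dots> \<le> l2_norm_vec u * l2_norm_vec v"
    unfolding l2_norm_vec_def using assms L2_set_mult_ineq[of "\<lambda>i. cmod (u $ i)" "\<lambda>i. cmod (v $ i)" "{..<n}"]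
    by simp
  finally show ?thesis .
qed

lemma isometry_norm:
  assumes "U \<in> carrier_mat m n" "mat_adjoint U * U = 1\<^sub>m n" "v \<in> carrier_vec n"
  shows "l2_norm_vec (U *\<^sub>v v) = l2_norm_vec v"
proof -
  have "(U *\<^sub>v v) \<bullet>c (U *\<^sub>v v) = v \<bullet>c (mat_adjoint U *\<^sub>v (U *\<^sub>v v))"
    using assms by (intro adjoint_cscalar_prod) auto
  also have "mat_adjoint U *\<^sub>v (U *\<^sub>v v) = v"
    using assms by (simp flip: assoc_mult_mat_vec[of _ n m _ n])
  finally have "(l2_norm_vec (U *\<^sub>v v))\<^sup>2 = (l2_norm_vec v)\<^sup>2"
    unfolding cscalar_prod_self of_real_eq_iff .
  thus ?thesis by simp
qed

lemma mult_mat_vec_norm_frobenius: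
  assumes "M \<in> carrier_mat m n" "v \<in> carrier_vec n"
  shows "l2_norm_vec (M *\<^sub>v v) \<le> sqrt (\<Sum>i<m. (l2_norm_vec (row M i))\<^sup>2) * l2_norm_vec v"
proof -
  have b: "cmod ((M *\<^sub>v v) $ i) \<le> l2_norm_vec (row M i) * l2_norm_vec v" if "i < m" for i
  proof -
    have "l2_norm_vec (conjugate v) = l2_norm_vec v"
      by (auto simp: l2_norm_vec_def intro!: L2_set_cong)
    thus ?thesis
      using cscalar_prod_bound[of "row M i" n "conjugate v"] that assms by simp
  qed
  have "(l2_norm_vec (M *\<^sub>v v))\<^sup>2 = (\<Sum>i<m. (cmod ((M *\<^sub>v v) $ i))\<^sup>2)"
    using assms by (intro l2_norm_vec_sq) auto
  also have "\<dots> \<le> (\<Sum>i<m. (l2_norm_vec (row M i) * l2_norm_vec v)\<^sup>2)"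
    using b by (intro sum_mono power_mono) auto
  also have "\<dots> = (sqrt (\<Sum>i<m. (l2_norm_vec (row M i))\<^sup>2) * l2_norm_vec v)\<^sup>2"
    by (simp add: power_mult_distrib sum_distrib_right sum_nonneg)
  finally show ?thesis
    by (rule power2_le_imp_le) (auto intro!: mult_nonneg_nonneg sum_nonneg)
qed

lemma spectral_norm_bdd:
  "bdd_above {l2_norm_vec (M *\<^sub>v v) |v. v \<in> carrier_vec (dim_col M) \<and> l2_norm_vec v \<le> 1}"
proof (rule bdd_aboveI, clarify)
  fix v :: "complex Matrix.vec" assume v: "v \<in> carrier_vec (dim_col M)" "l2_norm_vec v \<le> 1"
  have "l2_norm_vec (M *\<^sub>v v) \<le> sqrt (\<Sum>i<dim_row M. (l2_norm_vec (row M i))\<^sup>2) * l2_norm_vec v"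
    by (rule mult_mat_vec_norm_frobenius) (use v in auto)
  also have "\<dots> \<le> sqrt (\<Sum>i<dim_row M. (l2_norm_vec (row M i))\<^sup>2) * 1"
    using v by (intro mult_left_mono) (auto intro!: sum_nonneg)
  finally show "l2_norm_vec (M *\<^sub>v v) \<le> sqrt (\<Sum>i<dim_row M. (l2_norm_vec (row M i))\<^sup>2)" by simp
qed

lemma spectral_norm_leI:
  assumes "M \<in> carrier_mat m n"
    and "\<And>v. v \<in> carrier_vec n \<Longrightarrow> l2_norm_vec v \<le> 1 \<Longrightarrow> l2_norm_vec (M *\<^sub>v v) \<le> b"
  shows "spectral_norm M \<le> b"
  unfolding spectral_norm_def
proof (rule cSup_least)
  have "l2_norm_vec (M *\<^sub>v 0\<^sub>v (dim_col M)) \<in>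
      {l2_norm_vec (M *\<^sub>v v) |v. v \<in> carrier_vec (dim_col M) \<and> l2_norm_vec v \<le> 1}"
    by force
  thus "{l2_norm_vec (M *\<^sub>v v) |v. v \<in> carrier_vec (dim_col M) \<and> l2_norm_vec v \<le> 1} \<noteq> {}"
    by blast
qed (use assms in auto)

lemma spectral_norm_nonneg: "0 \<le> spectral_norm M"
proof -
  have "l2_norm_vec (M *\<^sub>v 0\<^sub>v (dim_col M)) \<le> spectral_norm M"
    unfolding spectral_norm_def by (rule cSup_upper[OF _ spectral_norm_bdd]) force
  thus ?thesis using l2_norm_vec_nonneg order_trans by blast
qed

lemma mult_mat_vec_norm_le:
  assumes "M \<in> carrier_mat m n" "v \<in> carrier_vec n"
  shows "l2_norm_vec (M *\<^sub>v v) \<le> spectral_norm M * l2_norm_vec v"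
proof (cases "l2_norm_vec v = 0")
  case True
  hence "v = 0\<^sub>v n" using assms l2_norm_vec_eq_0 by blast
  moreover have "M *\<^sub>v 0\<^sub>v n = 0\<^sub>v m" using assms by auto
  ultimately show ?thesis by simp
next
  case False
  hence pos: "l2_norm_vec v > 0" using l2_norm_vec_nonneg[of v] by linarith
  define a where "a = complex_of_real (1 / l2_norm_vec v)"
  have "l2_norm_vec (M *\<^sub>v (a \<cdot>\<^sub>v v)) \<le> spectral_norm M"
    unfolding spectral_norm_def
    by (rule cSup_upper[OF _ spectral_norm_bdd])
      (use assms pos in \<open>auto simp: a_def l2_norm_vec_smult norm_divide intro!: exI[of _ "a \<cdot>\<^sub>v v"]\<close>)
  moreover have "M *\<^sub>v (a \<cdot>\<^sub>v v) = a \<cdot>\<^sub>v (M *\<^sub>v v)"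
    using assms by (simp add: mult_mat_vec)
  ultimately have "l2_norm_vec (M *\<^sub>v v) / l2_norm_vec v \<le> spectral_norm M"
    using pos by (simp add: l2_norm_vec_smult a_def norm_divide)
  thus ?thesis using pos by (simp add: field_simps)
qed

section \<open>Unitary diagonalization of hermitian matrices\<close>

lemma unitary_matI:
  assumes "U \<in> carrier_mat n n" "mat_adjoint U * U = 1\<^sub>m n"
  shows "unitary_mat n U"
  unfolding unitary_mat_def
  using assms mat_mult_left_right_inverse[of "mat_adjoint U" n U] by auto

lemma unitary_mat_mult:
  assumes "unitary_mat n U" "unitary_mat n V"
  shows "unitary_mat n (U * V)"
proof (rule unitary_matI)
  have c: "U \<in> carrier_mat n n" "V \<in> carrier_mat n n"
    "mat_adjoint U \<in> carrier_mat n n" "mat_adjoint V \<in> carrier_mat n n"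
    using assms by (auto simp: unitary_mat_def)
  show "U * V \<in> carrier_mat n n" using c by simp
  have "mat_adjoint (U * V) * (U * V) = mat_adjoint V * ((mat_adjoint U * U) * V)"
    using c by (simp add: mat_adjoint_mult assoc_mult_mat[of _ n n _ n _ n] mult_carrier_mat[of _ n n _ n])
  also have "\<dots> = 1\<^sub>m n" using assms c by (simp add: unitary_mat_def)
  finally show "mat_adjoint (U * V) * (U * V) = 1\<^sub>m n" .
qed

text \<open>
  Gram-Schmidt orthogonalization of a basis that starts with \<open>v\<close> keeps \<open>v\<close> as its first vector;
  normalizing the result gives a unitary matrix.
\<close>

lemma unitary_with_first_column:
  fixes v :: "complex Matrix.vec"
  assumes v: "v \<in> carrier_vec n" "v \<noteq> 0\<^sub>v n" and n: "n \<noteq> 0"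
  shows "\<exists>W c. unitary_mat n W \<and> col W 0 = c \<cdot>\<^sub>v v"
proof -
  interpret cof_vec_space n "TYPE(complex)" .
  define ws where "ws = gram_schmidt n (basis_completion v)"
  define us where "us = map (\<lambda>w. complex_of_real (1 / l2_norm_vec w) \<cdot>\<^sub>v w) ws"
  define W where "W = mat_of_cols n us"
  note b = basis_completion[OF v]
  from gram_schmidt_result[OF b(2,4,5) refl, folded ws_def] b(6)
  have ws: "set ws \<subseteq> carrier_vec n" "corthogonal ws" "length ws = n" by auto
  obtain vs where bv: "basis_completion v = v # vs"
    using b(6,7) n by (cases "basis_completion v") auto
  have hdws: "ws ! 0 = v"
    using gram_schmidt_hd[OF v(1), of vs, folded bv] ws n
    unfolding ws_def[symmetric] by (cases ws) auto
  have wsi: "ws ! i \<in> carrier_vec n" if "i < n" for i using that ws by auto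
  have len: "length us = n" by (simp add: us_def ws)
  have usi: "us ! i = complex_of_real (1 / l2_norm_vec (ws ! i)) \<cdot>\<^sub>v ws ! i" if "i < n" for i
    using that ws by (simp add: us_def)
  have usc: "us ! i \<in> carrier_vec n" if "i < n" for i using that wsi usi by simp
  have W: "W \<in> carrier_mat n n" using len by (auto simp: W_def)
  have colW: "col W i = us ! i" if "i < n" for i
    using that len usc by (simp add: W_def)
  have us_orth: "us ! j \<bullet>c us ! i = (if i = j then 1 else 0)" if ij: "i < n" "j < n" for i j
  proof -
    have "us ! j \<bullet>c us ! i = complex_of_real (1 / l2_norm_vec (ws ! i)) *
       complex_of_real (1 / l2_norm_vec (ws ! j)) * (ws ! j \<bullet>c ws ! i)"
      using ij wsi[OF ij(1)] wsi[OF ij(2)] by (simp add: usi conjugate_smult_vec)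
    moreover have "l2_norm_vec (ws ! i) \<noteq> 0" if "i = j"
      using corthogonalD[OF ws(2), of i i] ij ws(3) cscalar_prod_self[of "ws ! i"] by auto
    ultimately show ?thesis
      using corthogonalD[OF ws(2), of j i] ij ws(3) cscalar_prod_self[of "ws ! i"]
      by (auto simp: power2_eq_square)
  qed
  have "mat_adjoint W * W = 1\<^sub>m n"
  proof (rule eq_matI)
    fix i j assume "i < dim_row (1\<^sub>m n :: complex mat)" "j < dim_col (1\<^sub>m n :: complex mat)"
    hence ij: "i < n" "j < n" by auto
    have "(mat_adjoint W * W) $$ (i, j) = conjugate (col W i) \<bullet> col W j"
      using ij W by (simp add: mat_adjoint_def)
    also have "\<dots> = us ! j \<bullet>c us ! i"
      using ij usc by (metis colW comm_scalar_prod carrier_vec_conjugate)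
    finally show "(mat_adjoint W * W) $$ (i, j) = 1\<^sub>m n $$ (i, j)"
      using us_orth ij by simp
  qed (use W in auto)
  hence "unitary_mat n W" using W by (rule unitary_matI[rotated])
  moreover have "col W 0 = complex_of_real (1 / l2_norm_vec v) \<cdot>\<^sub>v v"
    using colW[of 0] usi[of 0] n hdws by simp
  ultimately show ?thesis by blast
qed

lemma adjoint_block_diag:
  assumes "A \<in> carrier_mat a b" "D \<in> carrier_mat c d"
  shows "mat_adjoint (four_block_mat A (0\<^sub>m a d) (0\<^sub>m c b) D :: complex mat)
       = four_block_mat (mat_adjoint A) (0\<^sub>m b c) (0\<^sub>m d a) (mat_adjoint D)"
  by (rule eq_matI) (use assms in auto)

lemma mult_block_diag:
  assumes "A \<in> carrier_mat a b" "B \<in> carrier_mat b c" "D \<in> carrier_mat p q" "E \<in> carrier_mat q r"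
  shows "four_block_mat A (0\<^sub>m a q) (0\<^sub>m p b) D * (four_block_mat B (0\<^sub>m b r) (0\<^sub>m q c) E :: complex mat)
       = four_block_mat (A * B) (0\<^sub>m a r) (0\<^sub>m p c) (D * E)"
  by (subst mult_four_block_mat[of _ a b _ q _ p]) (use assms in auto)

text \<open>
  The order of the eigenvalues \<open>es\<close> is arbitrary, so that they may later be listed decreasingly.
  A unit eigenvector for the first one, completed to a unitary matrix \<open>W\<close>, makes the first column of
  \<open>W\<^sup>* H W\<close> a multiple of the first unit vector. By symmetry the first row has the same
  form, and what remains is a hermitian matrix of size \<open>n - 1\<close> with the remaining eigenvalues.
\<close>

theorem hermitian_diagonalization:
  fixes H :: "complex mat"
  assumes "H \<in> carrier_mat n n" "mat_adjoint H = H"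
    and "char_poly H = (\<Prod>e\<leftarrow>es. [:- e, 1:])"
  shows "\<exists>U. unitary_mat n U \<and> H = U * mat_diag n ((!) es) * mat_adjoint U"
  using assms
proof (induction es arbitrary: n H)
  case Nil
  with degree_monic_char_poly[of H n] have "n = 0" by simp
  with Nil show ?case
    by (intro exI[of _ "1\<^sub>m 0"]) (auto simp: unitary_mat_def intro!: eq_matI)
next
  case (Cons e es n H)
  note H = Cons.prems(1)
  let ?n1 = "n - 1"
  have mon: "monic (\<Prod>e\<leftarrow>es. [:- e, 1:])" by (rule monic_prod_list) auto
  have "degree (char_poly H) = Suc (degree (\<Prod>e\<leftarrow>es. [:- e, 1:]))"
    unfolding Cons.prems(3) list.map prod_list.Cons by (subst degree_mult_eq) (use mon in auto)
  hence n: "n \<noteq> 0" using degree_monic_char_poly[OF H] by auto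
  have "eigenvalue H e"
    unfolding eigenvalue_root_char_poly[OF H] Cons.prems(3) by simp
  then obtain v where v: "v \<in> carrier_vec n" "v \<noteq> 0\<^sub>v n" "H *\<^sub>v v = e \<cdot>\<^sub>v v"
    using H by (auto simp: eigenvalue_def eigenvector_def)
  obtain W c where W: "unitary_mat n W" and col0: "col W 0 = c \<cdot>\<^sub>v v"
    using unitary_with_first_column[OF v(1,2) n] by blast
  have Wc: "W \<in> carrier_mat n n" "mat_adjoint W \<in> carrier_mat n n"
    and WW: "mat_adjoint W * W = 1\<^sub>m n" "W * mat_adjoint W = 1\<^sub>m n"
    using W by (auto simp: unitary_mat_def)
  define H' where "H' = mat_adjoint W * H * W"
  have H': "H' \<in> carrier_mat n n" using Wc H by (auto simp: H'_def)
  have adjH': "mat_adjoint H' = H'"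
  proof -
    have "mat_adjoint H' = mat_adjoint W * (mat_adjoint H * W)"
      unfolding H'_def using Wc H
      by (simp add: mat_adjoint_mult[of _ n n _ n] mult_carrier_mat[of _ n n _ n])
    thus ?thesis using Cons.prems(2) Wc H by (simp add: H'_def assoc_mult_mat[of _ n n _ n _ n] mult_carrier_mat[of _ n n _ n])
  qed
  have HW: "H = W * H' * mat_adjoint W"
  proof -
    have "W * H' * mat_adjoint W = (W * mat_adjoint W) * H * (W * mat_adjoint W)"
      using Wc H by (simp add: H'_def assoc_mult_mat[of _ n n _ n _ n] mult_carrier_mat[of _ n n _ n])
    thus ?thesis using WW H by simp
  qed
  have colH': "col H' 0 = e \<cdot>\<^sub>v unit_vec n 0"
  proof -
    have "col H' 0 = (mat_adjoint W * H) *\<^sub>v col W 0"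
      unfolding H'_def using Wc H n by (intro col_mult2[of _ n n _ n]) auto
    also have "\<dots> = mat_adjoint W *\<^sub>v (H *\<^sub>v (c \<cdot>\<^sub>v v))"
      using Wc H v col0 by (simp add: assoc_mult_mat_vec[of _ n n _ n])
    also have "H *\<^sub>v (c \<cdot>\<^sub>v v) = e \<cdot>\<^sub>v col W 0"
      using v H col0 by (simp add: mult_mat_vec smult_smult_assoc mult.commute)
    also have "mat_adjoint W *\<^sub>v (e \<cdot>\<^sub>v col W 0) = e \<cdot>\<^sub>v col (mat_adjoint W * W) 0"
    proof -
      have "col W 0 \<in> carrier_vec n" using Wc by (auto intro: carrier_vecI)
      thus ?thesis
        using Wc n by (simp add: mult_mat_vec[of _ n n] col_mult2[of _ n n _ n])
    qed
    finally show ?thesis using WW n by simp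
  qed
  have c0: "H' $$ (i, 0) = (if i = 0 then e else 0)" if "i < n" for i
    using arg_cong[OF colH', of "\<lambda>x. x $ i"] that H' n by auto
  have r0: "H' $$ (0, i) = 0" if "i < n" "i \<noteq> 0" for i
    using arg_cong[OF adjH', of "\<lambda>x. x $$ (0, i)"] c0 that H' n by auto
  define H3 where "H3 = Matrix.mat ?n1 ?n1 (\<lambda>(i, j). H' $$ (Suc i, Suc j))"
  define E where "E = Matrix.mat 1 1 (\<lambda>_. e)"
  have H3: "H3 \<in> carrier_mat ?n1 ?n1" and E: "E \<in> carrier_mat 1 1"
    by (auto simp: H3_def E_def)
  have blk: "H' = four_block_mat E (0\<^sub>m 1 ?n1) (0\<^sub>m ?n1 1) H3"
    by (rule eq_matI) (use n H' c0 r0 in \<open>auto simp: H3_def E_def\<close>)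
  have "mat_adjoint H3 = H3"
  proof (rule eq_matI)
    fix i j assume "i < dim_row H3" "j < dim_col H3"
    hence ij: "Suc i < n" "Suc j < n" "i < ?n1" "j < ?n1" by (auto simp: H3_def)
    thus "mat_adjoint H3 $$ (i, j) = H3 $$ (i, j)"
      using arg_cong[OF adjH', of "\<lambda>x. x $$ (Suc i, Suc j)"] H' by (auto simp: H3_def)
  qed (auto simp: H3_def)
  moreover have "char_poly H3 = (\<Prod>e\<leftarrow>es. [:- e, 1:])"
  proof -
    have "similar_mat_wit H H' W (mat_adjoint W)"
      by (rule similar_mat_witI[OF WW(2,1) HW H H' Wc])
    hence "similar_mat H H'" unfolding similar_mat_def by blast
    hence "char_poly H' = [:- e, 1:] * (\<Prod>e\<leftarrow>es. [:- e, 1:])"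
      using char_poly_similar[of H H'] Cons.prems(3) by simp
    moreover have "char_poly H' = char_poly E * char_poly H3"
      unfolding blk by (rule char_poly_four_block_zeros_col[OF E _ H3]) simp
    moreover have "char_poly E = [:- e, 1:]"
      by (simp add: E_def char_poly_defs det_def sign_def)
    ultimately show ?thesis
      by (metis mult_cancel_left pCons_eq_0_iff zero_neq_one)
  qed
  ultimately obtain U3 where U3: "unitary_mat ?n1 U3"
    and H3U: "H3 = U3 * mat_diag ?n1 ((!) es) * mat_adjoint U3"
    using Cons.IH[OF H3] by blast
  have U3c: "U3 \<in> carrier_mat ?n1 ?n1" using U3 by (auto simp: unitary_mat_def)
  define V where "V = four_block_mat (1\<^sub>m 1) (0\<^sub>m 1 ?n1) (0\<^sub>m ?n1 1) U3"
  have Vc: "V \<in> carrier_mat n n" using U3c n by (auto simp: V_def intro!: carrier_matI)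
  have adjV: "mat_adjoint V = four_block_mat (1\<^sub>m 1) (0\<^sub>m 1 ?n1) (0\<^sub>m ?n1 1) (mat_adjoint U3)"
    unfolding V_def using adjoint_block_diag[of "1\<^sub>m 1" 1 1 U3 ?n1 ?n1] U3c by simp
  have V: "unitary_mat n V"
  proof (rule unitary_matI[OF Vc])
    have "mat_adjoint V * V = four_block_mat (1\<^sub>m 1) (0\<^sub>m 1 ?n1) (0\<^sub>m ?n1 1) (mat_adjoint U3 * U3)"
      unfolding adjV unfolding V_def
      using U3c mult_block_diag[of "1\<^sub>m 1" 1 1 "1\<^sub>m 1" 1 "mat_adjoint U3" ?n1 ?n1 U3 ?n1]
      by simp
    also have "\<dots> = 1\<^sub>m n"
      using U3 n by (simp add: unitary_mat_def four_block_one_mat)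
    finally show "mat_adjoint V * V = 1\<^sub>m n" .
  qed
  have "mat_diag n ((!) (e # es)) = four_block_mat E (0\<^sub>m 1 ?n1) (0\<^sub>m ?n1 1) (mat_diag ?n1 ((!) es))"
    by (rule eq_matI) (use n in \<open>auto simp: mat_diag_def E_def nth_Cons split: nat.splits\<close>)
  hence "V * mat_diag n ((!) (e # es)) * mat_adjoint V = H'"
    unfolding adjV blk H3U unfolding V_def
    using U3c E mat_diag_dim[of ?n1 "(!) es"]
      mult_block_diag[of "1\<^sub>m 1" 1 1 E 1 U3 ?n1 ?n1 "mat_diag ?n1 ((!) es)" ?n1]
      mult_block_diag[of E 1 1 "1\<^sub>m 1" 1 "U3 * mat_diag ?n1 ((!) es)" ?n1 ?n1 "mat_adjoint U3" ?n1]
    by simp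
  hence "H = W * (V * mat_diag n ((!) (e # es)) * mat_adjoint V) * mat_adjoint W"
    using HW by simp
  also have "\<dots> = (W * V) * mat_diag n ((!) (e # es)) * mat_adjoint (W * V)"
    using Wc Vc mat_diag_dim[of n "(!) (e # es)"] 
    by (simp add: mat_adjoint_mult[of _ n n _ n] assoc_mult_mat[of _ n n _ n _ n] mult_carrier_mat[of _ n n _ n])
  finally show ?case using unitary_mat_mult[OF W V] by blast
qed

section \<open>Pseudoinverses and singular values\<close>

text \<open>
  Quadratic forms are computed in the eigenbasis; this is the only way in which diagonalizations
  are used below.
\<close>

lemma diagonalization_form:
  assumes U: "unitary_mat n U" and H: "H = U * mat_diag n d * mat_adjoint U"
    and v: "v \<in> carrier_vec n"
  shows "(H *\<^sub>v v) \<bullet>c v = (\<Sum>i<n. d i * of_real ((cmod ((mat_adjoint U *\<^sub>v v) $ i))\<^sup>2))"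
proof -
  have Uc: "U \<in> carrier_mat n n" using U by (simp add: unitary_mat_def)
  define y where "y = mat_adjoint U *\<^sub>v v"
  have y: "y \<in> carrier_vec n" using Uc v unfolding y_def by (meson mat_adjoint_carrier mult_mat_vec_carrier)
  have "H *\<^sub>v v = U *\<^sub>v (mat_diag n d *\<^sub>v y)"
    unfolding H y_def using Uc v
    by (simp add: assoc_mult_mat_vec[of _ n n _ n] mult_carrier_mat[of _ n n _ n]
        mult_mat_vec_carrier[of _ n n])
  hence "(H *\<^sub>v v) \<bullet>c v = (mat_diag n d *\<^sub>v y) \<bullet>c y"
    using adjoint_cscalar_prod[OF Uc _ v, of "mat_diag n d *\<^sub>v y"] y
    unfolding y_def[symmetric] by (simp add: mult_mat_vec_carrier[of _ n n])
  also have "\<dots> = (\<Sum>i<n. (mat_diag n d *\<^sub>v y) $ i * cnj (y $ i))"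
    using y by (simp add: scalar_prod_def atLeast0LessThan)
  also have "\<dots> = (\<Sum>i<n. d i * of_real ((cmod (y $ i))\<^sup>2))"
  proof (intro sum.cong refl)
    fix i assume i: "i \<in> {..<n}"
    have "(mat_diag n d *\<^sub>v y) $ i = (\<Sum>j<n. (if i = j then d j else 0) * y $ j)"
      using i y by (auto simp: mat_diag_def scalar_prod_def atLeast0LessThan)
    also have "\<dots> = (\<Sum>j<n. if i = j then d j * y $ j else 0)"
      by (intro sum.cong) auto
    also have "\<dots> = d i * y $ i" using i by simp
    finally show "(mat_diag n d *\<^sub>v y) $ i * cnj (y $ i) = d i * of_real ((cmod (y $ i))\<^sup>2)"
      by (simp add: complex_norm_square del: of_real_power)
  qed
  finally show ?thesis by (simp add: y_def)
qed

lemma gram_form: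
  assumes "M \<in> carrier_mat l n" "v \<in> carrier_vec n"
  shows "((mat_adjoint M * M) *\<^sub>v v) \<bullet>c v = of_real ((l2_norm_vec (M *\<^sub>v v))\<^sup>2)"
proof -
  have "((mat_adjoint M * M) *\<^sub>v v) \<bullet>c v = (mat_adjoint M *\<^sub>v (M *\<^sub>v v)) \<bullet>c v"
    using assms by (simp add: assoc_mult_mat_vec[of _ n l _ n])
  also have "\<dots> = (M *\<^sub>v v) \<bullet>c (M *\<^sub>v v)"
    using adjoint_cscalar_prod[of "mat_adjoint M" n l "M *\<^sub>v v" v] assms by simp
  finally show ?thesis by (simp add: cscalar_prod_self)
qed

lemma unitary_pullback_norm:
  assumes "unitary_mat n U" "v \<in> carrier_vec n"
  shows "(\<Sum>i<n. (cmod ((mat_adjoint U *\<^sub>v v) $ i))\<^sup>2) = (l2_norm_vec v)\<^sup>2"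
proof -
  have Uc: "U \<in> carrier_mat n n" using assms by (simp add: unitary_mat_def)
  have "l2_norm_vec (mat_adjoint U *\<^sub>v v) = l2_norm_vec v"
    by (rule isometry_norm[of _ n n]) (use assms in \<open>auto simp: unitary_mat_def\<close>)
  thus ?thesis using l2_norm_vec_sq[of "mat_adjoint U *\<^sub>v v" n] Uc assms
    by (simp add: mult_mat_vec_carrier[of _ n n])
qed

lemma adjoint_mult_unitary_vec:
  assumes "unitary_mat n U" "w \<in> carrier_vec n"
  shows "mat_adjoint U *\<^sub>v (U *\<^sub>v w) = w"
  using assms by (simp add: unitary_mat_def flip: assoc_mult_mat_vec[of _ n n _ n])

lemma hermitian_gram: "mat_adjoint (mat_adjoint M * M) = mat_adjoint M * (M :: complex mat)"
  by (subst mat_adjoint_mult[of _ "dim_col M" "dim_row M" _ "dim_col M"]) (auto intro: carrier_matI)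

text \<open>
  The eigenvalues of \<open>M\<^sup>* M\<close> are values of the form \<open>v \<mapsto> \<parallel>M v\<parallel>\<^sup>2\<close> at unit vectors, hence real and
  nonnegative. Thus the squares of the singular values are these eigenvalues, and a second
  diagonalization may list them in decreasing order.
\<close>

theorem gram_diagonalization:
  assumes M: "M \<in> carrier_mat l n"
  obtains U where "unitary_mat n U" "length (singular_values M) = n"
    "\<And>x. x \<in> set (singular_values M) \<Longrightarrow> 0 \<le> x"
    "sorted (rev (singular_values M))"
    "mat_adjoint M * M =
       U * mat_diag n (\<lambda>i. of_real ((singular_values M ! i)\<^sup>2)) * mat_adjoint U"
proof -
  define G where "G = mat_adjoint M * M"
  define s where "s = singular_values M"
  define es where "es = map (\<lambda>x. complex_of_real (x\<^sup>2)) s"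
  have G: "G \<in> carrier_mat n n" using M by (auto simp: G_def)
  have herm: "mat_adjoint G = G" by (simp add: G_def hermitian_gram)
  obtain as where as: "char_poly G = (\<Prod>a\<leftarrow>as. [:- a, 1:])" "length as = n"
    using char_poly_factorized[OF G] by blast
  have roots: "proots (char_poly G) = mset as"
  proof -
    have "proots (\<Prod>a\<leftarrow>xs. [:- a, 1:]) = mset xs" for xs :: "complex list"
    proof (induction xs)
      case (Cons x xs)
      have "(\<Prod>a\<leftarrow>xs. [:- a, 1:]) \<noteq> (0 :: complex poly)"
        by (auto simp: prod_list_zero_iff)
      thus ?case
        using Cons unfolding list.map prod_list.Cons by (subst proots_mult) auto
    qed simp
    thus ?thesis using as(1) by simp
  qed
  obtain V where V: "unitary_mat n V" "G = V * mat_diag n ((!) as) * mat_adjoint V"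
    using hermitian_diagonalization[OF G herm as(1)] by blast
  have Vc: "V \<in> carrier_mat n n" using V(1) by (simp add: unitary_mat_def)
  have ev: "a = of_real (Re a) \<and> 0 \<le> Re a" if a: "a \<in> set as" for a
  proof -
    obtain i where i: "i < n" "a = as ! i" using a as(2) by (auto simp: in_set_conv_nth)
    define v where "v = V *\<^sub>v unit_vec n i"
    have v: "v \<in> carrier_vec n" using Vc by (simp add: v_def)
    have "(G *\<^sub>v v) \<bullet>c v = (\<Sum>j<n. as ! j * of_real ((cmod (unit_vec n i $ j))\<^sup>2))"
      using diagonalization_form[OF V v] adjoint_mult_unitary_vec[OF V(1), of "unit_vec n i"]
      by (simp add: v_def)
    also have "\<dots> = (\<Sum>j<n. if i = j then as ! j else 0)"
      using i(1) by (intro sum.cong refl) auto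
    also have "\<dots> = a" using i by simp
    finally have "a = of_real ((l2_norm_vec (M *\<^sub>v v))\<^sup>2)"
      using gram_form[OF M v] by (simp add: G_def)
    thus ?thesis by (metis Re_complex_of_real zero_le_power2)
  qed
  have mset_s: "mset s = image_mset (\<lambda>z. sqrt (Re z)) (mset as)"
    by (simp add: s_def singular_values_def roots flip: G_def)
  have "mset es = image_mset (\<lambda>a. complex_of_real ((sqrt (Re a))\<^sup>2)) (mset as)"
    by (simp add: es_def mset_s multiset.map_comp comp_def)
  also have "\<dots> = image_mset (\<lambda>a. a) (mset as)"
    by (rule image_mset_cong) (use ev in auto)
  finally have mset_es: "mset es = mset as" by simp
  have "char_poly G = (\<Prod>e\<leftarrow>es. [:- e, 1:])"
    unfolding as(1) using mset_es by (metis mset_map prod_mset_prod_list)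
  then obtain U where U: "unitary_mat n U" "G = U * mat_diag n ((!) es) * mat_adjoint U"
    using hermitian_diagonalization[OF G herm] by blast
  have len: "length s = n" using arg_cong[OF mset_s, of size] as(2) by simp
  have "mat_diag n ((!) es) = mat_diag n (\<lambda>i. of_real ((s ! i)\<^sup>2))"
    unfolding mat_diag_def using len by (intro cong_mat) (auto simp: es_def)
  moreover have "0 \<le> x" if "x \<in> set s" for x
  proof -
    have "x \<in># mset s" using that by simp
    thus ?thesis unfolding mset_s using ev by auto
  qed
  moreover have "sorted (rev s)"
    by (simp add: s_def singular_values_def)
  ultimately show ?thesis
    using that[of U] U len unfolding G_def s_def by simp
qed

lemma mat_eqI_vec:
  assumes "A \<in> carrier_mat m n" "B \<in> carrier_mat m n"
    and "\<And>v :: complex Matrix.vec. v \<in> carrier_vec n \<Longrightarrow> A *\<^sub>v v = B *\<^sub>v v"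
  shows "A = B"
proof (rule eq_matI)
  fix i j assume "i < dim_row B" "j < dim_col B"
  hence ij: "i < m" "j < n" using assms by auto
  have "A $$ (i, j) = (A *\<^sub>v unit_vec n j) $ i" using ij assms(1,2) by (simp add: scalar_prod_right_unit)
  also have "A *\<^sub>v unit_vec n j = B *\<^sub>v unit_vec n j" by (rule assms(3)) simp
  also have "(B *\<^sub>v unit_vec n j) $ i = B $$ (i, j)" using ij assms(1,2) by (simp add: scalar_prod_right_unit)
  finally show "A $$ (i, j) = B $$ (i, j)" .
qed (use assms in auto)

lemma vec_diff_eq_0:
  fixes a b :: "complex Matrix.vec"
  assumes "a \<in> carrier_vec n" "b \<in> carrier_vec n" "a - b = 0\<^sub>v n"
  shows "a = b"
proof (rule eq_vecI)
  fix i assume "i < dim_vec b"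
  thus "a $ i = b $ i" using arg_cong[OF assms(3), of "\<lambda>x. x $ i"] assms(1,2) by auto
qed (use assms in auto)

lemma mat_adjoint_mat_diag: "mat_adjoint (mat_diag n d) = mat_diag n (\<lambda>i. conjugate (d i))"
  by (rule eq_matI) (auto simp: mat_diag_def)

text \<open>
  With \<open>G\<close> the spectral pseudoinverse of \<open>M\<^sup>* M\<close> (nonzero eigenvalues inverted, zero ones kept, which
  is the behaviour of \<open>inverse\<close>), the matrix \<open>G M\<^sup>*\<close> is a pseudoinverse of \<open>M\<close>. Symmetry
  of \<open>M Z\<close> follows from that of \<open>G\<close>, and \<open>Z M\<close> is diagonal in the eigenbasis. For
  \<open>M Z M = M\<close>, the vector \<open>y = Z M v - v\<close> is annihilated by \<open>M\<^sup>* M\<close>, and then \<open>\<parallel>M y\<parallel>\<^sup>2 = 0\<close>.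
\<close>

lemma is_pinv_exists:
  assumes M: "M \<in> carrier_mat l n"
  shows "\<exists>Z. is_pinv M Z"
proof -
  obtain U where U: "unitary_mat n U" and G0: "mat_adjoint M * M =
       U * mat_diag n (\<lambda>i. of_real ((singular_values M ! i)\<^sup>2)) * mat_adjoint U"
    by (rule gram_diagonalization[OF M])
  define d where "d = (\<lambda>i. complex_of_real ((singular_values M ! i)\<^sup>2))"
  define d' where "d' = (\<lambda>i. inverse (d i))"
  define conj_diag where "conj_diag f = U * mat_diag n f * mat_adjoint U" for f
  note assoc = assoc_mult_mat[of _ n n _ n _ n] mult_carrier_mat[of _ n n _ n]
  have Uc: "U \<in> carrier_mat n n" "mat_adjoint U \<in> carrier_mat n n" "mat_adjoint U * U = 1\<^sub>m n"
    using U by (auto simp: unitary_mat_def)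
  have cd: "conj_diag f \<in> carrier_mat n n" for f
    using Uc by (simp add: conj_diag_def assoc)
  have cd_mult: "conj_diag f * conj_diag g = conj_diag (\<lambda>i. f i * g i)" for f g
  proof -
    have "conj_diag f * conj_diag g
        = U * (mat_diag n f * ((mat_adjoint U * U) * (mat_diag n g * mat_adjoint U)))"
      unfolding conj_diag_def using Uc(1,2) by (simp add: assoc)
    also have "\<dots> = U * ((mat_diag n f * mat_diag n g) * mat_adjoint U)"
      unfolding Uc(3) using Uc(1,2) assoc_mult_mat[of "mat_diag n f" n n "mat_diag n g" n "mat_adjoint U" n]
      by (simp add: assoc left_mult_one_mat[of _ n n] del: mat_diag_diag)
    also have "\<dots> = conj_diag (\<lambda>i. f i * g i)"
      unfolding mat_diag_diag using Uc(1,2) by (simp add: conj_diag_def assoc)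
    finally show ?thesis .
  qed
  have cd_adj: "mat_adjoint (conj_diag f) = conj_diag f" if "\<And>i. cnj (f i) = f i" for f
    using Uc(1,2) that
    by (simp add: conj_diag_def assoc mat_adjoint_mult[of _ n n _ n] mat_adjoint_mat_diag)
  define G where "G = conj_diag d'"
  have H: "mat_adjoint M * M = conj_diag d" using G0 unfolding conj_diag_def d_def .
  have G: "G \<in> carrier_mat n n" "mat_adjoint G = G"
    by (auto simp: G_def cd d'_def d_def intro!: cd_adj)
  define Z where "Z = G * mat_adjoint M"
  have Ma: "mat_adjoint M \<in> carrier_mat n l" using M by simp
  have Z: "Z \<in> carrier_mat n l" using G Ma by (auto simp: Z_def)
  have ZM: "Z * M = conj_diag (\<lambda>i. d' i * d i)"
  proof -
    have "Z * M = G * (mat_adjoint M * M)"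
      unfolding Z_def by (rule assoc_mult_mat[OF G(1) Ma M])
    thus ?thesis by (simp add: H G_def cd_mult)
  qed
  have "mat_adjoint (M * Z) = M * Z"
  proof -
    have "mat_adjoint (M * Z) = mat_adjoint Z * mat_adjoint M"
      by (rule mat_adjoint_mult[OF M Z])
    also have "mat_adjoint Z = M * G"
      unfolding Z_def using mat_adjoint_mult[OF G(1) Ma] G(2) by simp
    also have "M * G * mat_adjoint M = M * Z"
      unfolding Z_def by (rule assoc_mult_mat[OF M G(1) Ma])
    finally show ?thesis .
  qed
  moreover have "mat_adjoint (Z * M) = Z * M"
    unfolding ZM by (rule cd_adj) (simp add: d'_def d_def)
  moreover have "Z * M * Z = Z"
  proof -
    have "Z * M * Z = (Z * M * G) * mat_adjoint M"
      unfolding Z_def using Ma G M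
      by (intro assoc_mult_mat[symmetric, of _ n n _ n _ l]) auto
    also have "Z * M * G = G"
    proof -
      have "d' i * d i * d' i = d' i" for i by (cases "d i = 0") (auto simp: d'_def)
      hence "(\<lambda>i. d' i * d i * d' i) = d'" by (rule ext)
      thus ?thesis unfolding ZM G_def cd_mult by (rule arg_cong)
    qed
    finally show ?thesis by (simp add: Z_def)
  qed
  moreover have "M * Z * M = M"
  proof -
    have "M * (Z * M) = M"
    proof (rule mat_eqI_vec)
      fix v :: "complex Matrix.vec" assume v: "v \<in> carrier_vec n"
      define y where "y = (Z * M) *\<^sub>v v - v"
      have ZMc: "Z * M \<in> carrier_mat n n" using Z M by auto
      have zv: "(Z * M) *\<^sub>v v \<in> carrier_vec n" using ZMc v by simp
      have y: "y \<in> carrier_vec n" using zv v by (simp add: y_def)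
      have "(mat_adjoint M * M) *\<^sub>v y = (conj_diag d * conj_diag (\<lambda>i. d' i * d i)) *\<^sub>v v - conj_diag d *\<^sub>v v"
        unfolding y_def ZM H using cd v
        by (simp add: mult_minus_distrib_mat_vec[of _ n n] mult_mat_vec_carrier[of _ n n] assoc_mult_mat_vec[of _ n n _ n])
      also have "\<dots> = 0\<^sub>v n"
      proof -
        have "conj_diag d * conj_diag (\<lambda>i. d' i * d i) = conj_diag d"
        proof -
          have "d i * (d' i * d i) = d i" for i by (cases "d i = 0") (auto simp: d'_def)
          hence "(\<lambda>i. d i * (d' i * d i)) = d" by (rule ext)
          thus ?thesis unfolding cd_mult by (rule arg_cong)
        qed
        thus ?thesis using mult_mat_vec_carrier[OF cd v] by simp
      qed
      finally have "l2_norm_vec (M *\<^sub>v y) = 0"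
        using gram_form[OF M y] y by simp
      hence "M *\<^sub>v y = 0\<^sub>v l"
        using M y by (subst (asm) l2_norm_vec_eq_0[of _ l]) auto
      moreover have "M *\<^sub>v y = M *\<^sub>v ((Z * M) *\<^sub>v v) - M *\<^sub>v v"
        unfolding y_def by (rule mult_minus_distrib_mat_vec[OF M zv v])
      ultimately have "M *\<^sub>v ((Z * M) *\<^sub>v v) - M *\<^sub>v v = 0\<^sub>v l" by simp
      hence "M *\<^sub>v ((Z * M) *\<^sub>v v) = M *\<^sub>v v"
        by (rule vec_diff_eq_0[rotated 2]) (use M v zv in \<open>auto intro!: mult_mat_vec_carrier\<close>)
      thus "M * (Z * M) *\<^sub>v v = M *\<^sub>v v"
        using assoc_mult_mat_vec[OF M ZMc v] by simp
    qed (use M Z in auto)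
    thus ?thesis using assoc_mult_mat[OF M Z M] by simp
  qed
  ultimately show ?thesis
    using Z M by (auto simp: is_pinv_def)
qed

text \<open>
  \<open>M Z\<close> and \<open>M W\<close> are orthogonal projections onto the same space, and so are \<open>Z M\<close> and \<open>W M\<close>;
  taking adjoints of \<open>M Z = (M W) (M Z)\<close> shows that they coincide.
\<close>

lemma is_pinv_unique:
  assumes "is_pinv M Z" "is_pinv M W"
  shows "Z = W"
proof -
  define l n where "l = dim_row M" and "n = dim_col M"
  have M: "M \<in> carrier_mat l n" by (simp add: l_def n_def)
  have Z: "Z \<in> carrier_mat n l" "M * Z * M = M" "Z * M * Z = Z"
      "mat_adjoint (M * Z) = M * Z" "mat_adjoint (Z * M) = Z * M"
    and W: "W \<in> carrier_mat n l" "M * W * M = M" "W * M * W = W"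
      "mat_adjoint (M * W) = M * W" "mat_adjoint (W * M) = W * M"
    using assms by (auto simp: is_pinv_def l_def n_def)
  note c = M Z(1) W(1)
  have 1: "M * Z = M * W"
  proof -
    have "M * Z = (M * W) * (M * Z)"
      using W(2) c assoc_mult_mat[of "M * W" l l M n Z l] by simp
    hence "M * Z = mat_adjoint ((M * W) * (M * Z))" using Z(4) by simp
    also have "\<dots> = (M * Z) * (M * W)"
      using c by (subst mat_adjoint_mult[of _ l l _ l]) (auto simp: Z(4) W(4))
    also have "\<dots> = M * W"
      using Z(2) c assoc_mult_mat[of "M * Z" l l M n W l] by simp
    finally show ?thesis .
  qed
  have 2: "Z * M = W * M"
  proof -
    have "Z * M = (Z * M) * (W * M)"
      using W(2) c assoc_mult_mat[of Z n l M n "W * M" n] assoc_mult_mat[of M l n W l M n] by simp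
    hence "Z * M = mat_adjoint ((Z * M) * (W * M))" using Z(5) by simp
    also have "\<dots> = (W * M) * (Z * M)"
      using c by (subst mat_adjoint_mult[of _ n n _ n]) (auto simp: Z(5) W(5))
    also have "\<dots> = W * M"
      using Z(2) c assoc_mult_mat[of W n l M n "Z * M" n] assoc_mult_mat[of M l n Z l M n] by simp
    finally show ?thesis .
  qed
  have "Z = W * M * Z" using Z(3) 2 by simp
  also have "\<dots> = W * (M * Z)" by (rule assoc_mult_mat[OF W(1) M Z(1)])
  also have "\<dots> = W * M * W" unfolding 1 by (rule assoc_mult_mat[OF W(1) M W(1), symmetric])
  finally show ?thesis using W(3) by simp
qed

lemma is_pinv_pinv: "is_pinv M (pinv M)"
  unfolding pinv_def
proof -
  have "M \<in> carrier_mat (dim_row M) (dim_col M)" by (rule carrier_matI) simp_all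
  from is_pinv_exists[OF this] have "\<exists>!Z. is_pinv M Z" using is_pinv_unique by blast
  thus "is_pinv M (THE Z. is_pinv M Z)" by (rule theI')
qed

text \<open>
  The kernel of a \<open>k \<times> n\<close> matrix meets the span of the first \<open>k + 1\<close> coordinates nontrivially.
\<close>

lemma nonzero_kernel_vector:
  fixes K :: "complex mat"
  assumes K: "K \<in> carrier_mat k n" and kn: "k < n"
  obtains w where "w \<in> carrier_vec n" "w \<noteq> 0\<^sub>v n" "K *\<^sub>v w = 0\<^sub>v k"
    "\<And>j. j < n \<Longrightarrow> k < j \<Longrightarrow> w $ j = 0"
proof -
  \<comment> \<open>Row \<open>i\<close> with \<open>k \<le> i < n - 1\<close> forces coordinate \<open>i + 1\<close> to vanish; the last row is zero, so that the determinant vanishes.\<close>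
  define N where "N = Matrix.mat n n (\<lambda>(i, j).
     if i < k then K $$ (i, j) else if i = n - 1 then 0 else if j = Suc i then 1 else (0::complex))"
  have N: "N \<in> carrier_mat n n" by (simp add: N_def)
  have "transpose_mat N *\<^sub>v unit_vec n (n - 1) = 0\<^sub>v n"
    by (rule eq_vecI) (use kn in \<open>auto simp: N_def scalar_prod_right_unit\<close>)
  moreover have "transpose_mat N \<in> carrier_mat n n" using N by simp
  ultimately have "det (transpose_mat N) = 0"
    using kn by (subst det_0_iff_vec_prod_zero_field[of _ n]) (auto intro!: exI[of _ "unit_vec n (n - 1)"])
  hence "det N = 0" using det_transpose[OF N] by simp
  then obtain w where w: "w \<in> carrier_vec n" "w \<noteq> 0\<^sub>v n" "N *\<^sub>v w = 0\<^sub>v n"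
    using det_0_iff_vec_prod_zero_field[OF N] by blast
  have Nw: "(\<Sum>j<n. N $$ (i, j) * w $ j) = 0" if "i < n" for i
    using arg_cong[OF w(3), of "\<lambda>x. x $ i"] that N w(1)
    by (simp add: scalar_prod_def atLeast0LessThan)
  have "K *\<^sub>v w = 0\<^sub>v k"
  proof (rule eq_vecI)
    fix i assume "i < dim_vec (0\<^sub>v k :: complex Matrix.vec)"
    hence i: "i < k" by simp
    have "(K *\<^sub>v w) $ i = (\<Sum>j<n. N $$ (i, j) * w $ j)"
      using i K w(1) kn by (simp add: scalar_prod_def atLeast0LessThan N_def)
    thus "(K *\<^sub>v w) $ i = 0\<^sub>v k $ i" using Nw[of i] i kn by simp
  qed (use K in auto)
  moreover have "w $ j = 0" if j: "j < n" "k < j" for j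
  proof -
    obtain i where i: "j = Suc i" using j by (cases j) auto
    have "(\<Sum>t<n. N $$ (i, t) * w $ t) = (\<Sum>t<n. if t = j then w $ t else 0)"
      using i j by (intro sum.cong) (auto simp: N_def)
    thus ?thesis using Nw[of i] i j by simp
  qed
  ultimately show ?thesis using that w(1,2) by blast
qed

text \<open>
  The easy half of the Eckart-Young theorem, with the approximating matrix of rank \<open>k\<close> given only
  through the space on which it vanishes, the kernel of \<open>K\<close>. This kernel contains a nonzero
  combination of the first \<open>k + 1\<close> right singular vectors, and \<open>M\<close> stretches such a vector by at
  least \<open>\<sigma>\<^sub>k\<^sub>+\<^sub>1\<close>.
\<close>

theorem sing_val_le:
  assumes M: "M \<in> carrier_mat l n" and K: "K \<in> carrier_mat k n" and s: "0 \<le> s"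
    and bound: "\<And>v. v \<in> carrier_vec n \<Longrightarrow> K *\<^sub>v v = 0\<^sub>v k \<Longrightarrow>
                  l2_norm_vec (M *\<^sub>v v) \<le> s * l2_norm_vec v"
  shows "sing_val (k + 1) M \<le> s"
proof -
  obtain U where U: "unitary_mat n U" and len: "length (singular_values M) = n"
    and nonneg: "\<And>x. x \<in> set (singular_values M) \<Longrightarrow> 0 \<le> x"
    and sorted: "sorted (rev (singular_values M))"
    and G: "mat_adjoint M * M =
       U * mat_diag n (\<lambda>i. of_real ((singular_values M ! i)\<^sup>2)) * mat_adjoint U"
    using gram_diagonalization[OF M] by blast
  define \<sigma> where "\<sigma> = singular_values M"
  show ?thesis
  proof (cases "k < n")
    case False
    thus ?thesis using len s by (simp add: sing_val_def)
  next
    case True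
    have Uc: "U \<in> carrier_mat n n" using U by (simp add: unitary_mat_def)
    have KU: "K * U \<in> carrier_mat k n" using K Uc by simp
    obtain w where w: "w \<in> carrier_vec n" "w \<noteq> 0\<^sub>v n" "(K * U) *\<^sub>v w = 0\<^sub>v k"
      and w0: "\<And>j. j < n \<Longrightarrow> k < j \<Longrightarrow> w $ j = 0"
      using nonzero_kernel_vector[OF KU True] by blast
    define v where "v = U *\<^sub>v w"
    have v: "v \<in> carrier_vec n" using Uc w by (simp add: v_def)
    have Kv: "K *\<^sub>v v = 0\<^sub>v k" using w K Uc by (simp add: v_def)
    have nv: "l2_norm_vec v = l2_norm_vec w"
      unfolding v_def by (rule isometry_norm[OF Uc _ w(1)]) (use U in \<open>simp add: unitary_mat_def\<close>)
    have wpos: "l2_norm_vec w > 0"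
      using w l2_norm_vec_eq_0[OF w(1)] l2_norm_vec_nonneg[of w] by linarith
    have \<sigma>k: "0 \<le> \<sigma> ! k" using nonneg True len by (simp add: \<sigma>_def)
    have mono: "\<sigma> ! k \<le> \<sigma> ! i" if "i \<le> k" for i
      using sorted_rev_nth_mono[of \<sigma> i k] sorted that True len by (simp add: \<sigma>_def)
    have "complex_of_real ((l2_norm_vec (M *\<^sub>v v))\<^sup>2)
        = (\<Sum>i<n. of_real ((\<sigma> ! i)\<^sup>2) * of_real ((cmod (w $ i))\<^sup>2))"
      using gram_form[OF M v] diagonalization_form[OF U G v]
      by (simp add: v_def adjoint_mult_unitary_vec[OF U w(1)] \<sigma>_def)
    also have "\<dots> = complex_of_real (\<Sum>i<n. (\<sigma> ! i)\<^sup>2 * (cmod (w $ i))\<^sup>2)"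
      by simp
    finally have "(l2_norm_vec (M *\<^sub>v v))\<^sup>2 = (\<Sum>i<n. (\<sigma> ! i)\<^sup>2 * (cmod (w $ i))\<^sup>2)"
      unfolding of_real_eq_iff .
    moreover have "(\<Sum>i<n. (\<sigma> ! k)\<^sup>2 * (cmod (w $ i))\<^sup>2) \<le> (\<Sum>i<n. (\<sigma> ! i)\<^sup>2 * (cmod (w $ i))\<^sup>2)"
    proof (rule sum_mono)
      fix i assume "i \<in> {..<n}"
      show "(\<sigma> ! k)\<^sup>2 * (cmod (w $ i))\<^sup>2 \<le> (\<sigma> ! i)\<^sup>2 * (cmod (w $ i))\<^sup>2"
        using mono[of i] w0[of i] \<sigma>k \<open>i \<in> {..<n}\<close>
        by (cases "i \<le> k") (auto intro!: mult_right_mono power_mono)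
    qed
    ultimately have "(\<sigma> ! k * l2_norm_vec w)\<^sup>2 \<le> (l2_norm_vec (M *\<^sub>v v))\<^sup>2"
      by (simp add: power_mult_distrib l2_norm_vec_sq[OF w(1)] sum_distrib_left)
    hence "\<sigma> ! k * l2_norm_vec w \<le> l2_norm_vec (M *\<^sub>v v)"
      by (rule power2_le_imp_le) simp
    also have "\<dots> \<le> s * l2_norm_vec w"
      using bound[OF v Kv] nv by simp
    finally have "\<sigma> ! k \<le> s" using wpos by simp
    thus ?thesis using True len by (simp add: sing_val_def \<sigma>_def)
  qed
qed

section \<open>Words and exponential generating functions\<close>

text \<open>
  Words serve both as samples of rows and as the index sequences in the expansion of a power of a
  sum of noncommuting matrices.
\<close>

definition words :: "'a set \<Rightarrow> nat \<Rightarrow> 'a list set" where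
  "words A p = {w. set w \<subseteq> A \<and> length w = p}"

lemma finite_words [simp]: "finite A \<Longrightarrow> finite (words A p)"
  by (simp add: words_def finite_lists_length_eq)

lemma card_words: "finite A \<Longrightarrow> card (words A p) = card A ^ p"
  by (simp add: words_def card_lists_length_eq)

lemma words_0 [simp]: "words A 0 = {[]}"
  by (auto simp: words_def)

lemma sum_words_Suc: "(\<Sum>w\<in>words A (Suc p). g w) = (\<Sum>j\<in>A. \<Sum>w\<in>words A p. g (j # w))"
proof -
  have "(\<Sum>w\<in>words A (Suc p). g w) = (\<Sum>(j, w)\<in>A \<times> words A p. g (j # w))"
    by (rule sum.reindex_bij_witness[of _ "\<lambda>(j, w). j # w" "\<lambda>w. (hd w, tl w)"])
      (auto simp: words_def length_Suc_conv)
  thus ?thesis by (simp add: sum.cartesian_product)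
qed

lemma sum_words_prod: "(\<Sum>w\<in>words A p. \<Prod>a\<leftarrow>w. h a) = (\<Sum>a\<in>A. h a :: 'b :: comm_semiring_1) ^ p"
  by (induction p) (simp_all add: sum_words_Suc sum_distrib_left[symmetric] sum_distrib_right[symmetric])

lemma fps_deriv_prod_remove:
  fixes F :: "'a \<Rightarrow> real fps"
  assumes "finite A"
  shows "fps_deriv (\<Prod>i\<in>A. F i) = (\<Sum>j\<in>A. fps_deriv (F j) * (\<Prod>i\<in>A - {j}. F i))"
  using assms
proof (induction A)
  case (insert a A)
  have "(\<Prod>i\<in>insert a A - {j}. F i) = F a * (\<Prod>i\<in>A - {j}. F i)" if "j \<in> A" for j
  proof -
    have "insert a A - {j} = insert a (A - {j})" using that insert by auto
    thus ?thesis using insert by simp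
  qed
  hence "(\<Sum>j\<in>A. fps_deriv (F j) * (\<Prod>i\<in>insert a A - {j}. F i)) = F a * fps_deriv (\<Prod>i\<in>A. F i)"
    by (simp add: insert.IH sum_distrib_left mult.left_commute)
  thus ?case using insert by (simp add: algebra_simps insert.hyps)
qed simp

text \<open>
  The product formula for exponential generating functions: a weight of a word that is a product,
  over the letters, of functions of the multiplicities has the product of the one-letter series
  as its generating function. Removing the first letter \<open>j\<close> of a word shifts the weight of \<open>j\<close> by
  one, which is differentiation of the series of \<open>j\<close>; so the induction step is the Leibniz rule.
\<close>

theorem sum_words_count_egf:
  fixes f :: "'a \<Rightarrow> nat \<Rightarrow> real"
  assumes A: "finite A"
  shows "(\<Sum>w\<in>words A p. \<Prod>i\<in>A. f i (count_list w i))
       = fact p * fps_nth (\<Prod>i\<in>A. Abs_fps (\<lambda>r. f i r / fact r)) p"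
proof (induction p arbitrary: f)
  case 0
  have "fps_nth (\<Prod>i\<in>B. Abs_fps (\<lambda>r. f i r / fact r)) 0 = (\<Prod>i\<in>B. f i 0)" for B
    by (induction B rule: infinite_finite_induct) (simp_all add: fps_mult_nth)
  thus ?case by simp
next
  case (Suc p)
  define F where "F i = Abs_fps (\<lambda>r. f i r / fact r)" for i
  have deriv: "Abs_fps (\<lambda>r. f i (Suc r) / fact r) = fps_deriv (F i)" for i
    by (rule fps_ext) (simp add: F_def field_simps del: of_nat_Suc)
  have "(\<Sum>w\<in>words A p. \<Prod>i\<in>A. f i (count_list (j # w) i))
      = fact p * fps_nth (fps_deriv (F j) * (\<Prod>i\<in>A - {j}. F i)) p" if j: "j \<in> A" for j
  proof -
    define g where "g i = (if i = j then \<lambda>r. f i (Suc r) else f i)" for i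
    have "(\<Sum>w\<in>words A p. \<Prod>i\<in>A. f i (count_list (j # w) i))
        = (\<Sum>w\<in>words A p. \<Prod>i\<in>A. g i (count_list w i))"
      by (intro sum.cong prod.cong refl) (auto simp: g_def)
    also have "\<dots> = fact p * fps_nth (\<Prod>i\<in>A. Abs_fps (\<lambda>r. g i r / fact r)) p"
      by (rule Suc.IH)
    also have "(\<Prod>i\<in>A. Abs_fps (\<lambda>r. g i r / fact r))
        = Abs_fps (\<lambda>r. g j r / fact r) * (\<Prod>i\<in>A - {j}. Abs_fps (\<lambda>r. g i r / fact r))"
      by (rule prod.remove[OF A j])
    also have "Abs_fps (\<lambda>r. g j r / fact r) = fps_deriv (F j)"
      using deriv[of j] by (simp add: g_def)
    also have "(\<Prod>i\<in>A - {j}. Abs_fps (\<lambda>r. g i r / fact r)) = (\<Prod>i\<in>A - {j}. F i)"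
      by (intro prod.cong refl) (auto simp: g_def F_def)
    finally show ?thesis .
  qed
  hence "(\<Sum>w\<in>words A (Suc p). \<Prod>i\<in>A. f i (count_list w i))
      = (\<Sum>j\<in>A. fact p * fps_nth (fps_deriv (F j) * (\<Prod>i\<in>A - {j}. F i)) p)"
    unfolding sum_words_Suc by (intro sum.cong refl)
  also have "\<dots> = fact p * fps_nth (fps_deriv (\<Prod>i\<in>A. F i)) p"
    by (simp add: fps_deriv_prod_remove[OF A] fps_sum_nth sum_distrib_left)
  finally show ?case by (simp add: F_def)
qed

text \<open>
  Words weighted by \<open>q\<close> for every letter that occurs exactly once. The series of one letter is
  \<open>exp X - (1 - q) X\<close>, and it is evaluated at \<open>1\<close>.
\<close>

lemma singleton_weight_sums:
  fixes q :: real
  shows "(\<lambda>p. (\<Sum>w\<in>words {..<l} p. \<Prod>i<l. if count_list w i = 1 then q else 1) / fact p)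
           sums (exp 1 - (1 - q)) ^ l"
proof -
  define F where "F = fps_exp (1::real) - fps_const (1 - q) * fps_X"
  have radX: "fps_conv_radius (fps_const (1 - q) * fps_X) = \<infinity>"
    using fps_conv_radius_mult[of "fps_const (1 - q)" fps_X] by simp
  have rad: "fps_conv_radius F = \<infinity>"
    using fps_conv_radius_diff[of "fps_exp 1" "fps_const (1 - q) * fps_X"] radX by (simp add: F_def)
  have "F = Abs_fps (\<lambda>r. (if r = 1 then q else 1) / fact r)"
    by (rule fps_ext) (auto simp: F_def fps_X_def)
  hence "(\<Sum>w\<in>words {..<l} p. \<Prod>i<l. if count_list w i = 1 then q else 1) / fact p
      = fps_nth (F ^ l) p" for p
    using sum_words_count_egf[of "{..<l}" "\<lambda>_ r. if r = 1 then q else 1" p] by simp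
  moreover have "(\<lambda>p. fps_nth (F ^ l) p * 1 ^ p) sums eval_fps (F ^ l) 1"
    by (rule sums_eval_fps) (use fps_conv_radius_power[of F l] rad in simp)
  moreover have "eval_fps (F ^ l) 1 = (exp 1 - (1 - q)) ^ l"
    using rad radX by (simp add: eval_fps_power F_def eval_fps_diff eval_fps_mult)
  ultimately show ?thesis by simp
qed

section \<open>Sums of random positive contractions\<close>

text \<open>
  Drawing the \<open>i\<close>-th entry of a uniform sample afresh does not change averages: exchanging \<open>R ! i\<close>
  with the new value \<open>a\<close> is an involution on the pairs \<open>(R, a)\<close>.
\<close>

lemma sum_words_resample:
  fixes g :: "nat list \<Rightarrow> complex"
  assumes "i < l"
  shows "(\<Sum>R\<in>words {..<m} l. \<Sum>a<m. g (R[i := a])) = of_nat m * (\<Sum>R\<in>words {..<m} l. g R)"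
proof -
  have mem: "R \<in> words {..<m} l \<longleftrightarrow> length R = l \<and> (\<forall>i<l. R ! i < m)" for R
    by (auto simp: words_def set_conv_nth)
  have "(\<Sum>R\<in>words {..<m} l. \<Sum>a<m. g (R[i := a]))
      = (\<Sum>(R, a)\<in>words {..<m} l \<times> {..<m}. g (R[i := a]))"
    by (simp add: sum.cartesian_product)
  also have "\<dots> = (\<Sum>(R, a)\<in>words {..<m} l \<times> {..<m}. g R)"
    by (rule sum.reindex_bij_witness[of _ "\<lambda>(R, a). (R[i := a], R ! i)" "\<lambda>(R, a). (R[i := a], R ! i)"])
      (use assms in \<open>auto simp: mem nth_list_update intro!: nth_equalityI split: if_splits\<close>)
  also have "\<dots> = of_nat m * (\<Sum>R\<in>words {..<m} l. g R)"
    by (simp flip: sum.cartesian_product add: sum_distrib_left)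
  finally show ?thesis .
qed

text \<open>
  The trace of \<open>S ^ p\<close> is the sum of the \<open>p\<close>-th powers of the nonnegative eigenvalues, and the largest
  eigenvalue is at least every value of the quadratic form at a unit vector. The trace is written
  out so that powers of \<open>S\<close> only act on vectors.
\<close>

lemma trace_power_ge:
  fixes S :: "complex mat"
  assumes S: "S \<in> carrier_mat k k" "mat_adjoint S = S"
    and psd: "\<And>v. v \<in> carrier_vec k \<Longrightarrow> 0 \<le> Re ((S *\<^sub>v v) \<bullet>c v)"
    and u: "u \<in> carrier_vec k" "l2_norm_vec u = 1" and t: "0 \<le> t" "t \<le> Re ((S *\<^sub>v u) \<bullet>c u)"
  shows "t ^ p \<le> (\<Sum>j<k. Re ((((*\<^sub>v) S) ^^ p) (unit_vec k j) \<bullet>c unit_vec k j))"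
proof -
  obtain es where es: "char_poly S = (\<Prod>e\<leftarrow>es. [:- e, 1:])"
    using char_poly_factorized[OF S(1)] by blast
  obtain U where U: "unitary_mat k U" and SU: "S = U * mat_diag k ((!) es) * mat_adjoint U"
    using hermitian_diagonalization[OF S es] by blast
  have Uc: "U \<in> carrier_mat k k" using U by (simp add: unitary_mat_def)
  have real: "0 \<le> Re (es ! i)" "es ! i = of_real (Re (es ! i))" if i: "i < k" for i
  proof -
    define v where "v = U *\<^sub>v unit_vec k i"
    have v: "v \<in> carrier_vec k" using Uc by (simp add: v_def)
    have "(S *\<^sub>v v) \<bullet>c v = (\<Sum>j<k. es ! j * of_real ((cmod (unit_vec k i $ j))\<^sup>2))"
      using diagonalization_form[OF U SU v] adjoint_mult_unitary_vec[OF U, of "unit_vec k i"]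
      by (simp add: v_def)
    also have "\<dots> = (\<Sum>j<k. if i = j then es ! j else 0)"
      using i by (intro sum.cong refl) auto
    finally have e: "(S *\<^sub>v v) \<bullet>c v = es ! i" using i by simp
    show "0 \<le> Re (es ! i)" using psd[OF v] e by simp
    have "es ! i = v \<bullet>c (S *\<^sub>v v)"
      using e adjoint_cscalar_prod[OF S(1) v v] S(2) by simp
    also have "\<dots> = cnj (es ! i)"
    proof -
      have Sv: "S *\<^sub>v v \<in> carrier_vec k" using S(1) v by simp
      have "conjugate (es ! i) = conjugate (conjugate v \<bullet> (S *\<^sub>v v))"
        using conjugate_vec_sprod_comm[OF Sv v] e by simp
      thus ?thesis using conjugate_conjugate_sprod[OF v Sv] by simp
    qed
    finally show "es ! i = of_real (Re (es ! i))"
      by (simp add: complex_eq_iff)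
  qed
  obtain i where i: "i < k" "t \<le> Re (es ! i)"
  proof (rule ccontr)
    assume "\<not> thesis"
    with that have lt: "Re (es ! i) < t" if "i < k" for i using that by force
    define y where "y = mat_adjoint U *\<^sub>v u"
    have "Re ((S *\<^sub>v u) \<bullet>c u) = (\<Sum>i<k. Re (es ! i) * (cmod (y $ i))\<^sup>2)"
      unfolding diagonalization_form[OF U SU u(1)] y_def[symmetric] by simp
    moreover have one: "(\<Sum>i<k. (cmod (y $ i))\<^sup>2) = 1"
      using unitary_pullback_norm[OF U u(1)] u(2) by (simp add: y_def)
    ultimately have "(\<Sum>i<k. (t - Re (es ! i)) * (cmod (y $ i))\<^sup>2) \<le> 0"
      using t(2) by (simp add: left_diff_distrib sum_subtractf flip: sum_distrib_left)
    moreover have "0 \<le> (t - Re (es ! i)) * (cmod (y $ i))\<^sup>2" if "i < k" for i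
      using lt[OF that] by simp
    ultimately have "\<forall>i<k. (t - Re (es ! i)) * (cmod (y $ i))\<^sup>2 = 0"
      using sum_nonneg_eq_0_iff[of "{..<k}" "\<lambda>i. (t - Re (es ! i)) * (cmod (y $ i))\<^sup>2"]
      using sum_nonneg[of "{..<k}" "\<lambda>i. (t - Re (es ! i)) * (cmod (y $ i))\<^sup>2"] by simp
    hence "\<forall>i<k. y $ i = 0" using lt by force
    thus False using one by simp
  qed
  have pow: "(((*\<^sub>v) S) ^^ p) v = (U * mat_diag k (\<lambda>i. (es ! i) ^ p) * mat_adjoint U) *\<^sub>v v"
    if v: "v \<in> carrier_vec k" for v
  proof (induction p)
    case 0
    thus ?case using U v Uc by (simp add: unitary_mat_def)
  next
    case (Suc p)
    note assoc = assoc_mult_mat_vec[of _ k k _ k] mult_carrier_mat[of _ k k _ k]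
        mult_mat_vec_carrier[of _ k k]
    define y where "y = mat_adjoint U *\<^sub>v v"
    have y: "y \<in> carrier_vec k" using Uc v by (simp add: y_def assoc)
    have "(((*\<^sub>v) S) ^^ Suc p) v
        = U *\<^sub>v (mat_diag k ((!) es) *\<^sub>v (mat_adjoint U *\<^sub>v (U *\<^sub>v (mat_diag k (\<lambda>i. (es ! i) ^ p) *\<^sub>v y))))"
      using Uc v Suc SU by (simp add: assoc y_def)
    also have "\<dots> = U *\<^sub>v ((mat_diag k ((!) es) * mat_diag k (\<lambda>i. (es ! i) ^ p)) *\<^sub>v y)"
      using adjoint_mult_unitary_vec[OF U, of "mat_diag k (\<lambda>i. (es ! i) ^ p) *\<^sub>v y"] y
        assoc_mult_mat_vec[of "mat_diag k ((!) es)" k k "mat_diag k (\<lambda>i. (es ! i) ^ p)" k y]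
      by (simp add: assoc del: mat_diag_diag)
    also have "\<dots> = (U * mat_diag k (\<lambda>i. (es ! i) ^ Suc p) * mat_adjoint U) *\<^sub>v v"
      using Uc v by (simp add: assoc y_def)
    finally show ?case .
  qed
  have "(\<Sum>j<k. Re ((((*\<^sub>v) S) ^^ p) (unit_vec k j) \<bullet>c unit_vec k j))
      = (\<Sum>j<k. \<Sum>i<k. (Re (es ! i)) ^ p * (cmod (U $$ (j, i)))\<^sup>2)"
  proof (intro sum.cong refl)
    fix j assume "j \<in> {..<k}"
    hence j: "j < k" by simp
    have "(((*\<^sub>v) S) ^^ p) (unit_vec k j) \<bullet>c unit_vec k j
        = (\<Sum>i<k. (es ! i) ^ p * of_real ((cmod ((mat_adjoint U *\<^sub>v unit_vec k j) $ i))\<^sup>2))"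
      unfolding pow[OF unit_vec_carrier] by (rule diagonalization_form[OF U refl]) simp
    also have "\<dots> = (\<Sum>i<k. of_real ((Re (es ! i)) ^ p * (cmod (U $$ (j, i)))\<^sup>2))"
    proof (intro sum.cong refl)
      fix i assume "i \<in> {..<k}"
      hence i: "i < k" by simp
      have "cmod ((mat_adjoint U *\<^sub>v unit_vec k j) $ i) = cmod (U $$ (j, i))"
        using i j Uc by (simp add: scalar_prod_right_unit)
      moreover have "(es ! i) ^ p = of_real ((Re (es ! i)) ^ p)"
        using real(2)[OF i] by (metis of_real_power)
      ultimately show "(es ! i) ^ p * of_real ((cmod ((mat_adjoint U *\<^sub>v unit_vec k j) $ i))\<^sup>2)
          = of_real ((Re (es ! i)) ^ p * (cmod (U $$ (j, i)))\<^sup>2)"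
        by (simp only: of_real_mult)
    qed
    finally show "Re ((((*\<^sub>v) S) ^^ p) (unit_vec k j) \<bullet>c unit_vec k j)
        = (\<Sum>i<k. (Re (es ! i)) ^ p * (cmod (U $$ (j, i)))\<^sup>2)"
      by (simp flip: of_real_sum)
  qed
  also have "\<dots> = (\<Sum>i<k. (Re (es ! i)) ^ p * (\<Sum>j<k. (cmod (U $$ (j, i)))\<^sup>2))"
    by (subst sum.swap) (simp add: sum_distrib_left)
  also have "\<dots> = (\<Sum>i<k. (Re (es ! i)) ^ p)"
  proof (intro sum.cong refl)
    fix i assume "i \<in> {..<k}"
    hence i: "i < k" by simp
    have "l2_norm_vec (U *\<^sub>v unit_vec k i) = 1"
      using isometry_norm[OF Uc _ unit_vec_carrier, of i] U i by (simp add: unitary_mat_def)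
    moreover have "(l2_norm_vec (U *\<^sub>v unit_vec k i))\<^sup>2 = (\<Sum>j<k. (cmod (U $$ (j, i)))\<^sup>2)"
      using i Uc by (subst l2_norm_vec_sq[of _ k]) (auto simp: scalar_prod_right_unit)
    ultimately show "(Re (es ! i)) ^ p * (\<Sum>j<k. (cmod (U $$ (j, i)))\<^sup>2) = (Re (es ! i)) ^ p"
      by simp
  qed
  also have "(Re (es ! i)) ^ p \<le> \<dots>"
    using real(1) i(1) by (intro member_le_sum) auto
  moreover have "t ^ p \<le> (Re (es ! i)) ^ p" using t(1) i(2) by (intro power_mono)
  ultimately show ?thesis by linarith
qed

text \<open>
  Hermitian matrices \<open>0 \<le> Q\<^sub>a \<le> I\<close> whose average over a uniformly random \<open>a < m\<close> is \<open>q I\<close>. The last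
  condition is stated through sesquilinear forms, the only form in which averages are taken.
\<close>

locale random_contractions =
  fixes Q :: "nat \<Rightarrow> complex mat" and k m :: nat and q :: real
  assumes carrier: "a < m \<Longrightarrow> Q a \<in> carrier_mat k k"
    and hermitian: "a < m \<Longrightarrow> mat_adjoint (Q a) = Q a"
    and contraction: "a < m \<Longrightarrow> v \<in> carrier_vec k \<Longrightarrow> l2_norm_vec (Q a *\<^sub>v v) \<le> l2_norm_vec v"
    and positive: "a < m \<Longrightarrow> v \<in> carrier_vec k \<Longrightarrow> 0 \<le> Re ((Q a *\<^sub>v v) \<bullet>c v)"
    and average: "x \<in> carrier_vec k \<Longrightarrow> z \<in> carrier_vec k \<Longrightarrow>
      (\<Sum>a<m. (Q a *\<^sub>v x) \<bullet>c z) = of_nat m * of_real q * (x \<bullet>c z)"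
    and q_nonneg: "0 \<le> q" and m_pos: "0 < m" and k_pos: "0 < k"
begin

definition apply_word :: "nat list \<Rightarrow> nat list \<Rightarrow> complex Matrix.vec \<Rightarrow> complex Matrix.vec" where
  "apply_word R w v = foldr (\<lambda>i. (*\<^sub>v) (Q (R ! i))) w v"

lemma apply_word_simps [simp]:
  "apply_word R [] v = v" "apply_word R (i # w) v = Q (R ! i) *\<^sub>v apply_word R w v"
  "apply_word R (xs @ ys) v = apply_word R xs (apply_word R ys v)"
  by (simp_all add: apply_word_def)

lemma index_less: "R \<in> words {..<m} l \<Longrightarrow> i < l \<Longrightarrow> R ! i < m"
  by (auto simp: words_def dest: nth_mem)

lemma apply_word_carrier:
  assumes "R \<in> words {..<m} l" "v \<in> carrier_vec k"
  shows "set w \<subseteq> {..<l} \<Longrightarrow> apply_word R w v \<in> carrier_vec k"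
  by (induction w) (use assms in \<open>auto intro!: mult_mat_vec_carrier carrier index_less\<close>)

lemma apply_word_norm:
  assumes "R \<in> words {..<m} l" "v \<in> carrier_vec k"
  shows "set w \<subseteq> {..<l} \<Longrightarrow> l2_norm_vec (apply_word R w v) \<le> l2_norm_vec v"
proof (induction w)
  case (Cons i w)
  have "l2_norm_vec (Q (R ! i) *\<^sub>v apply_word R w v) \<le> l2_norm_vec (apply_word R w v)"
    using Cons assms by (intro contraction apply_word_carrier) (auto simp: index_less)
  thus ?case using Cons by simp
qed simp

lemma apply_word_adjoint:
  assumes R: "R \<in> words {..<m} l" and u: "u \<in> carrier_vec k"
  shows "set w \<subseteq> {..<l} \<Longrightarrow> v \<in> carrier_vec k \<Longrightarrow>
     apply_word R w v \<bullet>c u = v \<bullet>c apply_word R (rev w) u"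
  using u
proof (induction w arbitrary: u)
  case (Cons i w)
  hence i: "R ! i < m" using R by (auto simp: index_less)
  have w: "apply_word R w v \<in> carrier_vec k" using Cons R by (auto intro!: apply_word_carrier)
  have "apply_word R (i # w) v \<bullet>c u = apply_word R w v \<bullet>c (Q (R ! i) *\<^sub>v u)"
    using adjoint_cscalar_prod[OF carrier[OF i] w Cons.prems(3)] hermitian[OF i] by simp
  also have "\<dots> = v \<bullet>c apply_word R (rev w) (Q (R ! i) *\<^sub>v u)"
    using Cons carrier[OF i] by (intro Cons.IH) (auto intro: mult_mat_vec_carrier)
  finally show ?case by simp
qed simp

lemma apply_word_update:
  "i \<notin> set w \<Longrightarrow> apply_word (R[i := a]) w v = apply_word R w v"
  by (induction w) auto

text \<open>
  The estimate that replaces an inequality for matrix exponentials. If a letter occurs exactly once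
  in \<open>w\<close>, then the corresponding factor is independent of the others, and averaging over it
  replaces it by the scalar \<open>q\<close>; being scalar, it can be pulled out of the product wherever it
  stands. When no such letter is left, the remaining product of contractions is bounded by \<open>1\<close>.
  The sum over \<open>R\<close> is \<open>m ^ l\<close> times the expectation.
\<close>

lemma expectation_apply_word:
  assumes u: "u \<in> carrier_vec k" and v: "v \<in> carrier_vec k"
  shows "set w \<subseteq> {..<l} \<Longrightarrow>
    cmod (\<Sum>R\<in>words {..<m} l. apply_word R w v \<bullet>c u)
      \<le> real m ^ l * (\<Prod>i<l. if count_list w i = 1 then q else 1) * (l2_norm_vec v * l2_norm_vec u)"
proof (induction "length w" arbitrary: w rule: less_induct)
  case less
  show ?case
  proof (cases "\<exists>i<l. count_list w i = 1")
    case False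
    have "cmod (\<Sum>R\<in>words {..<m} l. apply_word R w v \<bullet>c u)
        \<le> (\<Sum>R\<in>words {..<m} l. l2_norm_vec v * l2_norm_vec u)"
    proof (rule sum_norm_le)
      fix R assume R: "R \<in> words {..<m} l"
      have "cmod (apply_word R w v \<bullet>c u) \<le> l2_norm_vec (apply_word R w v) * l2_norm_vec u"
        using apply_word_carrier[OF R v less.prems] u by (rule cscalar_prod_bound)
      also have "\<dots> \<le> l2_norm_vec v * l2_norm_vec u"
        using apply_word_norm[OF R v less.prems] by (intro mult_right_mono) auto
      finally show "cmod (apply_word R w v \<bullet>c u) \<le> l2_norm_vec v * l2_norm_vec u" .
    qed
    moreover have "(\<Prod>i<l. if count_list w i = 1 then q else 1) = 1"
      using False by (intro prod.neutral) auto
    ultimately show ?thesis by (simp add: card_words)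
  next
    case True
    then obtain i where i: "i < l" "count_list w i = 1" by blast
    hence "i \<in> set w" by (metis count_list_0_iff zero_neq_one)
    then obtain xs ys where w: "w = xs @ i # ys" by (meson split_list)
    have fresh: "i \<notin> set xs" "i \<notin> set ys" using i(2) by (auto simp: w count_list_0_iff[symmetric])
    have sub: "set (xs @ ys) \<subseteq> {..<l}" "set xs \<subseteq> {..<l}" "set ys \<subseteq> {..<l}"
      using less.prems by (auto simp: w)
    have step: "(\<Sum>a<m. apply_word (R[i := a]) w v \<bullet>c u)
        = of_nat m * of_real q * (apply_word R (xs @ ys) v \<bullet>c u)"
      if R: "R \<in> words {..<m} l" for R
    proof -
      have len: "length R = l" using R by (simp add: words_def)
      define x where "x = apply_word R ys v"
      define z where "z = apply_word R (rev xs) u"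
      have x: "x \<in> carrier_vec k" unfolding x_def by (rule apply_word_carrier[OF R v sub(3)])
      have z: "z \<in> carrier_vec k" unfolding z_def using sub by (intro apply_word_carrier[OF R u]) auto
      have "apply_word (R[i := a]) w v \<bullet>c u = (Q a *\<^sub>v x) \<bullet>c z" if a: "a < m" for a
      proof -
        have "apply_word (R[i := a]) w v = apply_word R xs (Q a *\<^sub>v x)"
          using i len by (simp add: w fresh apply_word_update x_def)
        thus ?thesis
          using apply_word_adjoint[OF R u sub(2), of "Q a *\<^sub>v x"] mult_mat_vec_carrier[OF carrier[OF a] x]
          by (simp add: z_def)
      qed
      hence "(\<Sum>a<m. apply_word (R[i := a]) w v \<bullet>c u) = (\<Sum>a<m. (Q a *\<^sub>v x) \<bullet>c z)"
        by (intro sum.cong) auto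
      also have "\<dots> = of_nat m * of_real q * (x \<bullet>c z)" by (rule average[OF x z])
      also have "x \<bullet>c z = apply_word R (xs @ ys) v \<bullet>c u"
        using apply_word_adjoint[OF R u sub(2) x] by (simp add: z_def x_def)
      finally show ?thesis .
    qed
    have "of_nat m * (\<Sum>R\<in>words {..<m} l. apply_word R w v \<bullet>c u)
        = (\<Sum>R\<in>words {..<m} l. \<Sum>a<m. apply_word (R[i := a]) w v \<bullet>c u)"
      by (rule sum_words_resample[OF i(1), symmetric])
    also have "\<dots> = of_nat m * (of_real q * (\<Sum>R\<in>words {..<m} l. apply_word R (xs @ ys) v \<bullet>c u))"
      using step by (simp add: sum_distrib_left mult.assoc)
    finally have "(\<Sum>R\<in>words {..<m} l. apply_word R w v \<bullet>c u)
        = of_real q * (\<Sum>R\<in>words {..<m} l. apply_word R (xs @ ys) v \<bullet>c u)"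
      using m_pos by simp
    hence "cmod (\<Sum>R\<in>words {..<m} l. apply_word R w v \<bullet>c u)
        = q * cmod (\<Sum>R\<in>words {..<m} l. apply_word R (xs @ ys) v \<bullet>c u)"
      using q_nonneg by (simp add: norm_mult)
    also have "\<dots> \<le> q * (real m ^ l * (\<Prod>j<l. if count_list (xs @ ys) j = 1 then q else 1)
        * (l2_norm_vec v * l2_norm_vec u))"
      using less.hyps[OF _ sub(1)] q_nonneg by (intro mult_left_mono) (auto simp: w)
    also have "\<dots> = real m ^ l * (q * (\<Prod>j<l. if count_list (xs @ ys) j = 1 then q else 1))
        * (l2_norm_vec v * l2_norm_vec u)"
      by simp
    also have "q * (\<Prod>j<l. if count_list (xs @ ys) j = 1 then q else 1)
        = (\<Prod>j<l. if count_list w j = 1 then q else 1)"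
    proof -
      have "(\<Prod>j\<in>{..<l}. if count_list w j = 1 then q else 1)
          = q * (\<Prod>j\<in>{..<l} - {i}. if count_list w j = 1 then q else 1)"
        using i by (subst prod.remove[of _ i]) auto
      also have "(\<Prod>j\<in>{..<l} - {i}. if count_list w j = 1 then q else 1)
          = (\<Prod>j\<in>{..<l} - {i}. if count_list (xs @ ys) j = 1 then q else 1)"
        by (intro prod.cong) (auto simp: w)
      also have "\<dots> = (\<Prod>j\<in>{..<l}. if count_list (xs @ ys) j = 1 then q else 1)"
        using i fresh by (subst (2) prod.remove[of _ i]) (auto simp: count_list_0_iff[symmetric])
      finally show ?thesis by simp
    qed
    finally show ?thesis .
  qed
qed

definition total :: "nat list \<Rightarrow> complex mat" where
  "total R = Matrix.mat k k (\<lambda>(a, b). \<Sum>i<length R. Q (R ! i) $$ (a, b))"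

lemma total_carrier: "total R \<in> carrier_mat k k"
  by (simp add: total_def)

lemma total_form:
  assumes R: "R \<in> words {..<m} l" and v: "v \<in> carrier_vec k" and u: "u \<in> carrier_vec k"
  shows "(total R *\<^sub>v v) \<bullet>c u = (\<Sum>i<l. (Q (R ! i) *\<^sub>v v) \<bullet>c u)"
proof -
  have l: "length R = l" using R by (simp add: words_def)
  have Qc: "Q (R ! i) \<in> carrier_mat k k" if "i < l" for i using carrier index_less[OF R that] by blast
  have "(total R *\<^sub>v v) \<bullet>c u = (\<Sum>a<k. (\<Sum>b<k. (\<Sum>i<l. Q (R ! i) $$ (a, b)) * v $ b) * cnj (u $ a))"
    using u v by (simp add: total_def l scalar_prod_def atLeast0LessThan)
  also have "\<dots> = (\<Sum>a<k. \<Sum>b<k. \<Sum>i<l. Q (R ! i) $$ (a, b) * v $ b * cnj (u $ a))"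
    by (simp add: sum_distrib_right)
  also have "\<dots> = (\<Sum>a<k. \<Sum>i<l. \<Sum>b<k. Q (R ! i) $$ (a, b) * v $ b * cnj (u $ a))"
    by (rule sum.cong[OF refl]) (rule sum.swap)
  also have "\<dots> = (\<Sum>i<l. \<Sum>a<k. \<Sum>b<k. Q (R ! i) $$ (a, b) * v $ b * cnj (u $ a))"
    by (rule sum.swap)
  also have "\<dots> = (\<Sum>i<l. (Q (R ! i) *\<^sub>v v) \<bullet>c u)"
  proof (intro sum.cong refl)
    fix i assume "i \<in> {..<l}"
    hence "Q (R ! i) \<in> carrier_mat k k" using Qc by simp
    thus "(\<Sum>a<k. \<Sum>b<k. Q (R ! i) $$ (a, b) * v $ b * cnj (u $ a)) = (Q (R ! i) *\<^sub>v v) \<bullet>c u"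
      using u v by (simp add: scalar_prod_def atLeast0LessThan sum_distrib_right)
  qed
  finally show ?thesis .
qed

lemma total_hermitian:
  assumes R: "R \<in> words {..<m} l"
  shows "mat_adjoint (total R) = total R"
proof (rule eq_matI)
  fix a b assume "a < dim_row (total R)" "b < dim_col (total R)"
  hence ab: "a < k" "b < k" by (auto simp: total_def)
  have l: "length R = l" using R by (simp add: words_def)
  have "cnj (Q (R ! i) $$ (b, a)) = Q (R ! i) $$ (a, b)" if "i < l" for i
  proof -
    have i: "R ! i < m" by (rule index_less[OF R that])
    show ?thesis
      using arg_cong[OF hermitian[OF i], of "\<lambda>M. M $$ (a, b)"] carrier[OF i] ab by simp
  qed
  thus "mat_adjoint (total R) $$ (a, b) = total R $$ (a, b)"
    using ab l by (simp add: total_def)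
qed (simp_all add: total_def)

lemma total_power_expand:
  assumes R: "R \<in> words {..<m} l" and v: "v \<in> carrier_vec k" and u: "u \<in> carrier_vec k"
  shows "(((*\<^sub>v) (total R)) ^^ p) v \<bullet>c u = (\<Sum>w\<in>words {..<l} p. apply_word R w v \<bullet>c u)"
  using u
proof (induction p arbitrary: u)
  case (Suc p)
  have pc: "(((*\<^sub>v) (total R)) ^^ p) v \<in> carrier_vec k" for p
    by (induction p) (use v total_carrier in \<open>auto intro: mult_mat_vec_carrier\<close>)
  have Qc: "Q (R ! i) \<in> carrier_mat k k" "mat_adjoint (Q (R ! i)) = Q (R ! i)"
    if "i < l" for i using carrier hermitian index_less[OF R that] by blast+
  have "(((*\<^sub>v) (total R)) ^^ Suc p) v \<bullet>c u
      = (\<Sum>i<l. (Q (R ! i) *\<^sub>v (((*\<^sub>v) (total R)) ^^ p) v) \<bullet>c u)"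
    using total_form[OF R pc Suc.prems] by simp
  also have "\<dots> = (\<Sum>i<l. (((*\<^sub>v) (total R)) ^^ p) v \<bullet>c (Q (R ! i) *\<^sub>v u))"
    using adjoint_cscalar_prod[OF Qc(1) pc Suc.prems] Qc(2) by (intro sum.cong) auto
  also have "\<dots> = (\<Sum>i<l. \<Sum>w\<in>words {..<l} p. apply_word R w v \<bullet>c (Q (R ! i) *\<^sub>v u))"
    using Qc Suc.prems by (intro sum.cong refl Suc.IH) (auto intro!: mult_mat_vec_carrier)
  also have "\<dots> = (\<Sum>i<l. \<Sum>w\<in>words {..<l} p. apply_word R (i # w) v \<bullet>c u)"
  proof (intro sum.cong refl)
    fix i w assume iw: "i \<in> {..<l}" "w \<in> words {..<l} p"
    have "apply_word R w v \<in> carrier_vec k"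
      using iw by (intro apply_word_carrier[OF R v]) (auto simp: words_def)
    thus "apply_word R w v \<bullet>c (Q (R ! i) *\<^sub>v u) = apply_word R (i # w) v \<bullet>c u"
      using adjoint_cscalar_prod[OF Qc(1) _ Suc.prems, of i] Qc(2) iw by simp
  qed
  also have "\<dots> = (\<Sum>w\<in>words {..<l} (Suc p). apply_word R w v \<bullet>c u)"
    by (rule sum_words_Suc[symmetric])
  finally show ?case .
qed simp

definition large_total :: "nat \<Rightarrow> real \<Rightarrow> nat list set" where
  "large_total l t = {R \<in> words {..<m} l.
     \<exists>u \<in> carrier_vec k. l2_norm_vec u = 1 \<and> t \<le> Re ((total R *\<^sub>v u) \<bullet>c u)}"

text \<open>
  Markov's inequality for the trace of \<open>total R ^ p\<close>, whose expectation is expanded into words.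
\<close>

lemma large_total_moment:
  assumes t: "0 \<le> t"
  shows "real (card (large_total l t)) * t ^ p
     \<le> real k * real m ^ l * (\<Sum>w\<in>words {..<l} p. \<Prod>i<l. if count_list w i = 1 then q else 1)"
proof -
  define tr where "tr R = (\<Sum>j<k. Re ((((*\<^sub>v) (total R)) ^^ p) (unit_vec k j) \<bullet>c unit_vec k j))" for R
  have sub: "large_total l t \<subseteq> words {..<m} l" by (auto simp: large_total_def)
  have psd: "0 \<le> Re ((total R *\<^sub>v v) \<bullet>c v)" if "R \<in> words {..<m} l" "v \<in> carrier_vec k" for R v
    unfolding total_form[OF that that(2)] Re_sum
    using that by (intro sum_nonneg positive) (auto simp: index_less)
  have ge: "s ^ p \<le> tr R" if "R \<in> words {..<m} l" "u \<in> carrier_vec k" "l2_norm_vec u = 1"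
      "0 \<le> s" "s \<le> Re ((total R *\<^sub>v u) \<bullet>c u)" for R u s
    unfolding tr_def by (rule trace_power_ge[OF total_carrier total_hermitian psd]) (use that in auto)
  have tr_nonneg: "0 \<le> tr R" if R: "R \<in> words {..<m} l" for R
  proof -
    have "0 ^ p \<le> tr R"
      using k_pos psd[OF R] by (intro ge[OF R, of "unit_vec k 0"]) auto
    thus ?thesis by (smt (verit) zero_le_power)
  qed
  have "real (card (large_total l t)) * t ^ p = (\<Sum>R\<in>large_total l t. t ^ p)" by simp
  also have "\<dots> \<le> (\<Sum>R\<in>large_total l t. tr R)"
    using t by (intro sum_mono) (auto simp: large_total_def intro: ge)
  also have "\<dots> \<le> (\<Sum>R\<in>words {..<m} l. tr R)"
    using sub tr_nonneg by (intro sum_mono2) auto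
  also have "\<dots> = (\<Sum>R\<in>words {..<m} l. \<Sum>j<k. \<Sum>w\<in>words {..<l} p.
      Re (apply_word R w (unit_vec k j) \<bullet>c unit_vec k j))"
    unfolding tr_def by (intro sum.cong refl) (simp add: total_power_expand)
  also have "\<dots> = (\<Sum>j<k. \<Sum>R\<in>words {..<m} l. \<Sum>w\<in>words {..<l} p.
      Re (apply_word R w (unit_vec k j) \<bullet>c unit_vec k j))"
    by (rule sum.swap)
  also have "\<dots> = (\<Sum>j<k. \<Sum>w\<in>words {..<l} p. \<Sum>R\<in>words {..<m} l.
      Re (apply_word R w (unit_vec k j) \<bullet>c unit_vec k j))"
    by (rule sum.cong[OF refl]) (rule sum.swap)
  also have "\<dots> \<le> (\<Sum>j<k. \<Sum>w\<in>words {..<l} p.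
      real m ^ l * (\<Prod>i<l. if count_list w i = 1 then q else 1))"
  proof (intro sum_mono)
    fix j w assume "j \<in> {..<k}" "w \<in> words {..<l} p"
    hence "cmod (\<Sum>R\<in>words {..<m} l. apply_word R w (unit_vec k j) \<bullet>c unit_vec k j)
        \<le> real m ^ l * (\<Prod>i<l. if count_list w i = 1 then q else 1)"
      using expectation_apply_word[of "unit_vec k j" "unit_vec k j" w l] by (simp add: words_def)
    thus "(\<Sum>R\<in>words {..<m} l. Re (apply_word R w (unit_vec k j) \<bullet>c unit_vec k j))
        \<le> real m ^ l * (\<Prod>i<l. if count_list w i = 1 then q else 1)"
      unfolding Re_sum[symmetric] using complex_Re_le_cmod order_trans by blast
  qed
  also have "\<dots> = real k * real m ^ l * (\<Sum>w\<in>words {..<l} p. \<Prod>i<l. if count_list w i = 1 then q else 1)"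
    by (simp add: sum_distrib_left[symmetric] mult.assoc)
  finally show ?thesis .
qed

text \<open>
  A matrix Chernoff bound. The moment bounds are combined with weights \<open>1 / p!\<close>, which turns the
  moments into an exponential moment and, on the other side, the weights of the words into their
  generating function. Here \<open>exp 1 - (1 - q)\<close> appears in the place of the usual
  \<open>1 + (exp 1 - 1) * q\<close>, a small loss in the constants only.
\<close>

theorem large_total_bound:
  assumes t: "0 \<le> t"
  shows "real (card (large_total l t)) * exp t \<le> real k * real m ^ l * (exp 1 - (1 - q)) ^ l"
proof -
  have s1: "(\<lambda>p. real (card (large_total l t)) * (t ^ p / fact p)) sums (real (card (large_total l t)) * exp t)"
    using exp_converges[of t] by (intro sums_mult) (simp add: divide_inverse mult.commute)
  have s2: "(\<lambda>p. real k * real m ^ l *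
      ((\<Sum>w\<in>words {..<l} p. \<Prod>i<l. if count_list w i = 1 then q else 1) / fact p))
      sums (real k * real m ^ l * (exp 1 - (1 - q)) ^ l)"
    by (intro sums_mult singleton_weight_sums)
  have le: "real (card (large_total l t)) * (t ^ p / fact p) \<le> real k * real m ^ l *
      ((\<Sum>w\<in>words {..<l} p. \<Prod>i<l. if count_list w i = 1 then q else 1) / fact p)" for p
    using divide_right_mono[OF large_total_moment[OF t, of l p], of "fact p"] by simp
  show ?thesis by (rule sums_le[OF le s1 s2])
qed

end

section \<open>Sampling rows of a matrix with orthonormal columns\<close>

definition sample_vec :: "nat list \<Rightarrow> complex Matrix.vec \<Rightarrow> complex Matrix.vec" where
  "sample_vec R g = Matrix.vec (length R) (\<lambda>i. g $ (R ! i))"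

lemma sample_vec_carrier [simp]: "R \<in> words A l \<Longrightarrow> sample_vec R g \<in> carrier_vec l"
  by (auto simp: sample_vec_def words_def)

lemma sample_vec_diff:
  assumes "R \<in> words {..<m} l" "g \<in> carrier_vec m" "h \<in> carrier_vec m"
  shows "sample_vec R (g - h) = sample_vec R g - sample_vec R h"
  by (rule eq_vecI) (use assms in \<open>auto simp: sample_vec_def words_def dest!: nth_mem\<close>)

lemma restrict_rows_mult_vec:
  assumes "A \<in> carrier_mat m n" "R \<in> words {..<m} l" "v \<in> carrier_vec n"
  shows "restrict_rows A R *\<^sub>v v = sample_vec R (A *\<^sub>v v)"
proof (rule eq_vecI)
  fix i assume "i < dim_vec (sample_vec R (A *\<^sub>v v))"
  hence i: "i < length R" by (simp add: sample_vec_def)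
  hence "R ! i < m" using assms(2) by (auto simp: words_def dest!: nth_mem)
  thus "(restrict_rows A R *\<^sub>v v) $ i = sample_vec R (A *\<^sub>v v) $ i"
    using assms i by (simp add: restrict_rows_def sample_vec_def scalar_prod_def)
qed (simp add: restrict_rows_def sample_vec_def)

lemma sample_vec_norm_sq:
  assumes "R \<in> words {..<m} l"
  shows "(l2_norm_vec (sample_vec R g))\<^sup>2 = (\<Sum>i<l. (cmod (g $ (R ! i)))\<^sup>2)"
  using assms by (subst l2_norm_vec_sq[of _ l]) (auto simp: sample_vec_def words_def)

lemma sum_list_count:
  fixes f :: "nat \<Rightarrow> real"
  shows "set R \<subseteq> {..<m} \<Longrightarrow> (\<Sum>r\<leftarrow>R. f r) = (\<Sum>r<m. real (count_list R r) * f r)"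
proof (induction R)
  case (Cons a R)
  have "(\<Sum>r<m. real (count_list (a # R) r) * f r)
      = (\<Sum>r<m. (if a = r then f r else 0) + real (count_list R r) * f r)"
    by (intro sum.cong refl) (auto simp: algebra_simps)
  also have "\<dots> = f a + (\<Sum>r<m. real (count_list R r) * f r)"
    using Cons.prems by (simp add: sum.distrib)
  finally show ?case using Cons by simp
qed simp

text \<open>
  Sampling with replacement can enlarge the norm, but only through repetitions.
\<close>

lemma sample_vec_norm_le:
  assumes R: "R \<in> words {..<m} l" and g: "g \<in> carrier_vec m"
    and mult: "\<And>r. r < m \<Longrightarrow> real (count_list R r) \<le> p"
  shows "l2_norm_vec (sample_vec R g) \<le> sqrt p * l2_norm_vec g"
proof -
  have sub: "set R \<subseteq> {..<m}" and l: "length R = l" using R by (auto simp: words_def)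
  have "(l2_norm_vec (sample_vec R g))\<^sup>2 = (\<Sum>r\<leftarrow>R. (cmod (g $ r))\<^sup>2)"
    unfolding sample_vec_norm_sq[OF R] by (simp add: sum_list_sum_nth l atLeast0LessThan)
  also have "\<dots> = (\<Sum>r<m. real (count_list R r) * (cmod (g $ r))\<^sup>2)"
    by (rule sum_list_count[OF sub])
  also have "\<dots> \<le> (\<Sum>r<m. p * (cmod (g $ r))\<^sup>2)"
    using mult by (intro sum_mono mult_right_mono) auto
  also have "\<dots> = p * (l2_norm_vec g)\<^sup>2"
    by (simp add: l2_norm_vec_sq[OF g] sum_distrib_left)
  finally have "(l2_norm_vec (sample_vec R g))\<^sup>2 \<le> p * (l2_norm_vec g)\<^sup>2" .
  hence "sqrt ((l2_norm_vec (sample_vec R g))\<^sup>2) \<le> sqrt (p * (l2_norm_vec g)\<^sup>2)"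
    by (rule real_sqrt_le_mono)
  thus ?thesis by (simp add: real_sqrt_mult)
qed

text \<open>
  Let \<open>x\<^sub>a\<^sup>*\<close> be the rows of \<open>X\<close>, so that \<open>\<parallel>x\<^sub>a\<parallel>\<^sup>2 \<le> K / m\<close> and \<open>\<Sum> x\<^sub>a x\<^sub>a\<^sup>* = I\<close>. Then
  \<open>Q\<^sub>a = I - (m / K) x\<^sub>a x\<^sub>a\<^sup>*\<close> is a positive contraction with average \<open>(1 - 1 / K) I\<close>. A sample for
  which the sampled rows almost annihilate a unit vector is one for which the sum of the \<open>Q\<^sub>a\<close> is
  large at that vector, and this is rare by \<open>large_total_bound\<close>.
\<close>

theorem row_sampling_lower_tail:
  assumes X: "X \<in> carrier_mat m k" "mat_adjoint X * X = 1\<^sub>m k" and k: "0 < k"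
    and rows: "\<And>a. a < m \<Longrightarrow> (\<Sum>j<k. (cmod (X $$ (a, j)))\<^sup>2) \<le> K / real m"
    and \<alpha>: "\<alpha> \<le> 1"
  shows "real (card {R \<in> words {..<m} l. \<exists>u \<in> carrier_vec k. l2_norm_vec u = 1 \<and>
            (l2_norm_vec (sample_vec R (X *\<^sub>v u)))\<^sup>2 < \<alpha> * real l / real m})
         \<le> real m ^ l * (real k * exp (- (real l / K) * (exp (-1) - \<alpha>)))"
proof -
  have norm_X: "l2_norm_vec (X *\<^sub>v v) = l2_norm_vec v" if "v \<in> carrier_vec k" for v
    using isometry_norm[OF X that] .
  have m: "0 < m"
  proof (rule ccontr)
    assume "\<not> 0 < m"
    hence "l2_norm_vec (X *\<^sub>v unit_vec k 0) = 0" using X by (simp add: l2_norm_vec_def L2_set_def)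
    thus False using norm_X[of "unit_vec k 0"] k by simp
  qed
  have K1: "1 \<le> K"
  proof -
    have "1 = (\<Sum>a<m. (cmod (X $$ (a, 0)))\<^sup>2)"
      using norm_X[of "unit_vec k 0"] k X l2_norm_vec_sq[of "X *\<^sub>v unit_vec k 0" m]
      by (simp add: scalar_prod_right_unit)
    also have "\<dots> \<le> (\<Sum>a<m. K / real m)"
    proof (intro sum_mono)
      fix a assume "a \<in> {..<m}"
      have "(cmod (X $$ (a, 0)))\<^sup>2 \<le> (\<Sum>j<k. (cmod (X $$ (a, j)))\<^sup>2)"
        using k by (intro member_le_sum) auto
      thus "(cmod (X $$ (a, 0)))\<^sup>2 \<le> K / real m" using rows[of a] \<open>a \<in> {..<m}\<close> by simp
    qed
    finally show ?thesis using m by simp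
  qed
  define c where "c = real m / K"
  have c: "0 < c" "c * (K / real m) = 1" using m K1 by (auto simp: c_def)
  define Q where "Q a = Matrix.mat k k (\<lambda>(i, j).
     (if i = j then 1 else 0) - of_real c * cnj (X $$ (a, i)) * X $$ (a, j))" for a
  define N where "N a = (\<Sum>j<k. (cmod (X $$ (a, j)))\<^sup>2)" for a
  have cN: "c * N a \<le> 1" if "a < m" for a
  proof -
    have "c * N a \<le> c * (K / real m)"
      unfolding N_def using rows[OF that] c by (intro mult_left_mono) auto
    thus ?thesis unfolding c(2) .
  qed
  have Qc: "Q a \<in> carrier_mat k k" for a by (simp add: Q_def)
  have Xv: "(X *\<^sub>v v) $ a = (\<Sum>j<k. X $$ (a, j) * v $ j)" if "a < m" "v \<in> carrier_vec k" for a v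
    using that X by (simp add: scalar_prod_def atLeast0LessThan)
  have Q_index: "(Q a *\<^sub>v v) $ i = v $ i - of_real c * cnj (X $$ (a, i)) * (X *\<^sub>v v) $ a"
    if "a < m" "i < k" "v \<in> carrier_vec k" for a i v
  proof -
    have "(Q a *\<^sub>v v) $ i = (\<Sum>j<k. ((if i = j then 1 else 0)
        - of_real c * cnj (X $$ (a, i)) * X $$ (a, j)) * v $ j)"
      using that by (simp add: Q_def scalar_prod_def atLeast0LessThan)
    also have "\<dots> = (\<Sum>j<k. (if i = j then v $ j else 0)
        - of_real c * cnj (X $$ (a, i)) * (X $$ (a, j) * v $ j))"
      by (intro sum.cong refl) (auto simp: algebra_simps)
    also have "\<dots> = v $ i - of_real c * cnj (X $$ (a, i)) * (X *\<^sub>v v) $ a"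
      using that by (simp add: Xv sum_subtractf sum_distrib_left)
    finally show ?thesis .
  qed
  have Q_form: "(Q a *\<^sub>v v) \<bullet>c u = v \<bullet>c u - of_real c * ((X *\<^sub>v v) $ a * cnj ((X *\<^sub>v u) $ a))"
    if a: "a < m" and v: "v \<in> carrier_vec k" and u: "u \<in> carrier_vec k" for a v u
  proof -
    have "(Q a *\<^sub>v v) \<bullet>c u = (\<Sum>i<k. (Q a *\<^sub>v v) $ i * cnj (u $ i))"
      using u Qc[of a] by (simp add: scalar_prod_def atLeast0LessThan)
    also have "\<dots> = (\<Sum>i<k. v $ i * cnj (u $ i)
        - of_real c * ((X *\<^sub>v v) $ a * cnj (X $$ (a, i) * u $ i)))"
      using a v by (intro sum.cong refl) (simp add: Q_index algebra_simps)
    also have "\<dots> = v \<bullet>c u - of_real c * ((X *\<^sub>v v) $ a * cnj ((X *\<^sub>v u) $ a))"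
      using u unfolding Xv[OF a u]
      by (simp add: scalar_prod_def atLeast0LessThan sum_subtractf sum_distrib_left)
    finally show ?thesis .
  qed
  have Q_self: "(Q a *\<^sub>v v) \<bullet>c v = of_real ((l2_norm_vec v)\<^sup>2 - c * (cmod ((X *\<^sub>v v) $ a))\<^sup>2)"
    if "a < m" "v \<in> carrier_vec k" for a v
    using Q_form[OF that that(2)] by (simp add: cscalar_prod_self complex_norm_square[symmetric])
  have row_bound: "(cmod ((X *\<^sub>v v) $ a))\<^sup>2 \<le> N a * (l2_norm_vec v)\<^sup>2"
    if "a < m" "v \<in> carrier_vec k" for a v
  proof -
    define x where "x = conjugate (row X a)"
    have x: "x \<in> carrier_vec k" using X by (auto simp: x_def)
    have "(X *\<^sub>v v) $ a = v \<bullet>c x"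
      using that X by (simp add: x_def comm_scalar_prod[of _ k])
    hence "cmod ((X *\<^sub>v v) $ a) \<le> l2_norm_vec v * l2_norm_vec x"
      using cscalar_prod_bound[OF that(2) x] by simp
    hence "(cmod ((X *\<^sub>v v) $ a))\<^sup>2 \<le> (l2_norm_vec v * l2_norm_vec x)\<^sup>2"
      by (intro power_mono) auto
    moreover have "(l2_norm_vec x)\<^sup>2 = N a"
      unfolding l2_norm_vec_sq[OF x] N_def using X that by (intro sum.cong refl) (simp add: x_def)
    ultimately show ?thesis by (simp add: power_mult_distrib mult.commute)
  qed
  interpret random_contractions Q k m "1 - 1 / K"
  proof
    fix a :: nat and v :: "complex Matrix.vec"
    assume a: "a < m" and v: "v \<in> carrier_vec k"
    define s where "s = (X *\<^sub>v v) $ a"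
    have "(l2_norm_vec (Q a *\<^sub>v v))\<^sup>2 = (\<Sum>i<k. (cmod (v $ i - of_real c * cnj (X $$ (a, i)) * s))\<^sup>2)"
      using Qc[of a] a v by (subst l2_norm_vec_sq[of _ k]) (auto simp: Q_index s_def simp del: index_mult_mat_vec)
    also have "\<dots> = (\<Sum>i<k. (cmod (v $ i))\<^sup>2 + c\<^sup>2 * (cmod s)\<^sup>2 * (cmod (X $$ (a, i)))\<^sup>2
        - 2 * c * Re (X $$ (a, i) * v $ i * cnj s))"
      by (intro sum.cong refl) (simp only: cmod_power2, simp add: power2_eq_square algebra_simps)
    also have "\<dots> = (l2_norm_vec v)\<^sup>2 + c\<^sup>2 * (cmod s)\<^sup>2 * N a - 2 * c * Re (s * cnj s)"
      unfolding l2_norm_vec_sq[OF v] N_def s_def Xv[OF a v] sum_distrib_right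
      by (simp only: sum.distrib sum_subtractf Re_sum sum_distrib_left)
    also have "Re (s * cnj s) = (cmod s)\<^sup>2" unfolding cmod_power2 by (simp add: power2_eq_square)
    also have "c\<^sup>2 * (cmod s)\<^sup>2 * N a = c * (cmod s)\<^sup>2 * (c * N a)"
      by (simp add: power2_eq_square)
    also have "\<dots> \<le> c * (cmod s)\<^sup>2 * 1"
      using cN[OF a] c by (intro mult_left_mono) auto
    also have "(l2_norm_vec v)\<^sup>2 + c * (cmod s)\<^sup>2 * 1 - 2 * c * (cmod s)\<^sup>2 \<le> (l2_norm_vec v)\<^sup>2"
      using c by simp
    finally have "(l2_norm_vec (Q a *\<^sub>v v))\<^sup>2 \<le> (l2_norm_vec v)\<^sup>2" by simp
    thus "l2_norm_vec (Q a *\<^sub>v v) \<le> l2_norm_vec v" by (rule power2_le_imp_le) simp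
    have "c * (cmod ((X *\<^sub>v v) $ a))\<^sup>2 \<le> c * (N a * (l2_norm_vec v)\<^sup>2)"
      using row_bound[OF a v] c by (intro mult_left_mono) auto
    also have "\<dots> = (c * N a) * (l2_norm_vec v)\<^sup>2" by simp
    also have "\<dots> \<le> 1 * (l2_norm_vec v)\<^sup>2" using cN[OF a] by (intro mult_right_mono) auto
    finally show "0 \<le> Re ((Q a *\<^sub>v v) \<bullet>c v)" unfolding Q_self[OF a v] by simp
  next
    fix x z :: "complex Matrix.vec" assume x: "x \<in> carrier_vec k" and z: "z \<in> carrier_vec k"
    have Xx: "X *\<^sub>v x \<in> carrier_vec m" "X *\<^sub>v z \<in> carrier_vec m" using X x z by auto
    have "(X *\<^sub>v x) \<bullet>c (X *\<^sub>v z) = x \<bullet>c (mat_adjoint X *\<^sub>v (X *\<^sub>v z))"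
      by (rule adjoint_cscalar_prod[OF X(1) x Xx(2)])
    also have "mat_adjoint X *\<^sub>v (X *\<^sub>v z) = z"
      using X z by (simp flip: assoc_mult_mat_vec[of _ k m _ k])
    finally have "(X *\<^sub>v x) \<bullet>c (X *\<^sub>v z) = x \<bullet>c z" .
    moreover have "(X *\<^sub>v x) \<bullet>c (X *\<^sub>v z) = (\<Sum>a<m. (X *\<^sub>v x) $ a * cnj ((X *\<^sub>v z) $ a))"
      using X by (simp add: scalar_prod_def[of "X *\<^sub>v x"] atLeast0LessThan)
    ultimately have iso: "(\<Sum>a<m. (X *\<^sub>v x) $ a * cnj ((X *\<^sub>v z) $ a)) = x \<bullet>c z"
      by simp
    have "(\<Sum>a<m. (Q a *\<^sub>v x) \<bullet>c z)
        = (\<Sum>a<m. x \<bullet>c z - of_real c * ((X *\<^sub>v x) $ a * cnj ((X *\<^sub>v z) $ a)))"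
      using x z by (intro sum.cong refl Q_form) auto
    also have "\<dots> = of_nat m * (x \<bullet>c z) - of_real c * (x \<bullet>c z)"
      unfolding iso[symmetric] by (simp add: sum_subtractf sum_distrib_left)
    also have "\<dots> = of_nat m * of_real (1 - 1 / K) * (x \<bullet>c z)"
      using K1 by (simp add: c_def algebra_simps)
    finally show "(\<Sum>a<m. (Q a *\<^sub>v x) \<bullet>c z) = of_nat m * of_real (1 - 1 / K) * (x \<bullet>c z)" .
  next
    fix a :: nat assume "a < m"
    show "mat_adjoint (Q a) = Q a"
      by (rule eq_matI) (auto simp: Q_def)
  qed (use Qc K1 m k in auto)
  define t where "t = real l * (1 - \<alpha> / K)"
  have t: "0 \<le> t" using \<alpha> K1 by (auto simp: t_def)
  have sub: "{R \<in> words {..<m} l. \<exists>u \<in> carrier_vec k. l2_norm_vec u = 1 \<and>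
      (l2_norm_vec (sample_vec R (X *\<^sub>v u)))\<^sup>2 < \<alpha> * real l / real m} \<subseteq> large_total l t"
  proof clarify
    fix R u assume R: "R \<in> words {..<m} l" and u: "u \<in> carrier_vec k" "l2_norm_vec u = 1"
      and small: "(l2_norm_vec (sample_vec R (X *\<^sub>v u)))\<^sup>2 < \<alpha> * real l / real m"
    have "(total R *\<^sub>v u) \<bullet>c u = (\<Sum>i<l. of_real (1 - c * (cmod ((X *\<^sub>v u) $ (R ! i)))\<^sup>2))"
      unfolding total_form[OF R u(1) u(1)]
      using Q_self[OF index_less[OF R] u(1)] u(2) by (intro sum.cong refl) simp
    hence "Re ((total R *\<^sub>v u) \<bullet>c u) = real l - c * (l2_norm_vec (sample_vec R (X *\<^sub>v u)))\<^sup>2"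
      unfolding sample_vec_norm_sq[OF R] by (simp add: sum_subtractf sum_distrib_left)
    moreover have "c * (l2_norm_vec (sample_vec R (X *\<^sub>v u)))\<^sup>2 \<le> c * (\<alpha> * real l / real m)"
      using small c by (intro mult_left_mono) auto
    moreover have "c * (\<alpha> * real l / real m) = real l * (\<alpha> / K)"
      using m by (simp add: c_def)
    ultimately have "t \<le> Re ((total R *\<^sub>v u) \<bullet>c u)"
      by (simp add: t_def algebra_simps)
    thus "R \<in> large_total l t" using R u by (auto simp: large_total_def)
  qed
  have fin: "finite (large_total l t)"
    by (rule finite_subset[of _ "words {..<m} l"]) (auto simp: large_total_def)
  have "exp 1 - 1 / K = exp 1 * (1 - exp (-1) / K)"
    using K1 by (simp add: field_simps exp_minus)
  also have "\<dots> \<le> exp 1 * exp (- exp (-1) / K)"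
    using exp_ge_add_one_self[of "- exp (-1) / K"] by (intro mult_left_mono) auto
  also have "\<dots> = exp (1 - exp (-1) / K)" by (simp flip: exp_add)
  finally have base: "exp 1 - 1 / K \<le> exp (1 - exp (-1) / K)" .
  have "0 \<le> exp 1 - 1 / K"
  proof -
    have "1 / K \<le> 1" using K1 by simp
    moreover have "1 \<le> exp (1::real)" by simp
    ultimately show ?thesis by linarith
  qed
  hence "(exp 1 - 1 / K) ^ l \<le> exp (1 - exp (-1) / K) ^ l"
    using base by (intro power_mono)
  also have "\<dots> = exp (real l * (1 - exp (-1) / K))" by (simp add: exp_of_nat_mult)
  also have "\<dots> = exp (- (real l / K) * (exp (-1) - \<alpha>)) * exp t"
    by (simp add: t_def algebra_simps flip: exp_add)
  finally have pw: "(exp 1 - 1 / K) ^ l \<le> exp (- (real l / K) * (exp (-1) - \<alpha>)) * exp t" .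
  have "real (card {R \<in> words {..<m} l. \<exists>u \<in> carrier_vec k. l2_norm_vec u = 1 \<and>
      (l2_norm_vec (sample_vec R (X *\<^sub>v u)))\<^sup>2 < \<alpha> * real l / real m}) * exp t
      \<le> real (card (large_total l t)) * exp t"
    using card_mono[OF fin sub] by simp
  also have "\<dots> \<le> real k * real m ^ l * (exp 1 - 1 / K) ^ l"
    using large_total_bound[OF t, of l] by simp
  also have "\<dots> \<le> real k * real m ^ l * (exp (- (real l / K) * (exp (-1) - \<alpha>)) * exp t)"
    using pw by (intro mult_left_mono) auto
  finally show ?thesis by (simp add: mult_ac)
qed

lemma prod_list_count: "(\<Prod>a\<leftarrow>R. if a = r then h else 1) = (h :: real) ^ count_list R r"
  by (induction R) auto

text \<open>
  The number of occurrences of a fixed row is a sum of independent indicators with exponential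
  moment \<open>(1 + (exp 1 - 1) / m) ^ l\<close>; a union bound over the \<open>m\<close> rows follows.
\<close>

theorem multiplicity_tail:
  assumes m: "0 < m"
  shows "real (card {R \<in> words {..<m} l. \<exists>r<m. t < real (count_list R r)})
         \<le> real m ^ l * (real m * exp (2 * real l / real m - t))"
proof -
  define S where "S r = {R \<in> words {..<m} l. t < real (count_list R r)}" for r
  have fin: "finite (S r)" for r
    by (rule finite_subset[of _ "words {..<m} l"]) (auto simp: S_def)
  have one: "real (card (S r)) \<le> real m ^ l * exp (2 * real l / real m - t)" if r: "r < m" for r
  proof -
    have "real (card (S r)) * exp t = (\<Sum>R\<in>S r. exp t)" by simp
    also have "\<dots> \<le> (\<Sum>R\<in>S r. exp 1 ^ count_list R r)"
    proof (rule sum_mono)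
      fix R assume "R \<in> S r"
      hence "exp t \<le> exp (real (count_list R r) * 1)" by (simp add: S_def)
      thus "exp t \<le> exp 1 ^ count_list R r" by (simp only: exp_of_nat_mult)
    qed
    also have "\<dots> \<le> (\<Sum>R\<in>words {..<m} l. exp 1 ^ count_list R r)"
      by (rule sum_mono2) (auto simp: S_def)
    also have "\<dots> = (\<Sum>a<m. if a = r then exp 1 else 1) ^ l"
      by (simp add: sum_words_prod[symmetric] prod_list_count)
    also have "(\<Sum>a<m. if a = r then exp 1 else 1) = exp 1 + (real m - 1)"
      using r by (subst sum.remove[of _ r]) (auto simp: of_nat_diff)
    also have "\<dots> ^ l \<le> (real m * exp (2 / real m)) ^ l"
    proof (rule power_mono)
      have "exp 1 + (real m - 1) \<le> real m * (1 + 2 / real m)"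
        using exp_le m by (simp add: field_simps)
      also have "\<dots> \<le> real m * exp (2 / real m)"
        by (intro mult_left_mono exp_ge_add_one_self) auto
      finally show "exp 1 + (real m - 1) \<le> real m * exp (2 / real m)" .
      show "0 \<le> exp 1 + (real m - 1)" using exp_ge_zero[of "1::real"] m by (simp add: add_nonneg_nonneg)
    qed
    also have "\<dots> = real m ^ l * exp (2 * real l / real m)"
      by (simp add: power_mult_distrib flip: exp_of_nat_mult)
    finally have "real (card (S r)) * exp t \<le> real m ^ l * exp (2 * real l / real m)" .
    thus ?thesis by (simp add: exp_diff field_simps)
  qed
  have "{R \<in> words {..<m} l. \<exists>r<m. t < real (count_list R r)} = (\<Union>r<m. S r)"
    by (auto simp: S_def)
  hence "real (card {R \<in> words {..<m} l. \<exists>r<m. t < real (count_list R r)}) \<le> (\<Sum>r<m. real (card (S r)))"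
    using card_UN_le[of "{..<m}" S] by (simp flip: of_nat_sum)
  also have "\<dots> \<le> (\<Sum>r<m. real m ^ l * exp (2 * real l / real m - t))"
    using one by (intro sum_mono) auto
  finally show ?thesis by (simp add: mult_ac)
qed

section \<open>Lifting the error from the sampled rows\<close>

text \<open>
  The adjoint of the selection of the coordinates \<open>C\<close>. It turns a combination of the selected
  columns of \<open>A\<close> into \<open>A\<close> applied to a vector.
\<close>

definition scatter_vec :: "nat \<Rightarrow> nat list \<Rightarrow> complex Matrix.vec \<Rightarrow> complex Matrix.vec" where
  "scatter_vec n C y = Matrix.vec n (\<lambda>i. \<Sum>j<length C. if C ! j = i then y $ j else 0)"

lemma scatter_vec_carrier [simp]: "scatter_vec n C y \<in> carrier_vec n"
  by (simp add: scatter_vec_def)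

lemma scatter_vec_norm:
  assumes C: "col_selection k n C" and y: "y \<in> carrier_vec k"
  shows "l2_norm_vec (scatter_vec n C y) = l2_norm_vec y"
proof -
  have len: "length C = k" and dist: "distinct C" and sub: "set C \<subseteq> {..<n}"
    using C by (auto simp: col_selection_def)
  define s where "s i = (\<Sum>j<k. if C ! j = i then y $ j else 0)" for i
  have s_out: "s i = 0" if "i \<notin> set C" for i
    unfolding s_def using that len by (intro sum.neutral) (auto dest: nth_mem)
  have s_in: "s (C ! j) = y $ j" if j: "j < k" for j
  proof -
    have "s (C ! j) = (\<Sum>j'<k. if j' = j then y $ j' else 0)"
      unfolding s_def using j len dist by (intro sum.cong refl) (auto simp: nth_eq_iff_index_eq)
    thus ?thesis using j by simp
  qed
  have "(l2_norm_vec (scatter_vec n C y))\<^sup>2 = (\<Sum>i<n. (cmod (s i))\<^sup>2)"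
    by (subst l2_norm_vec_sq[of _ n]) (auto simp: scatter_vec_def s_def len)
  also have "\<dots> = (\<Sum>i\<in>set C. (cmod (s i))\<^sup>2)"
    by (rule sum.mono_neutral_right) (use sub s_out in auto)
  also have "\<dots> = (\<Sum>j<k. (cmod (s (C ! j)))\<^sup>2)"
    by (rule sum.reindex_bij_betw[symmetric]) (use bij_betw_nth[OF dist, of "{..<k}" "set C"] len in auto)
  also have "\<dots> = (l2_norm_vec y)\<^sup>2"
    unfolding l2_norm_vec_sq[OF y] using s_in by (intro sum.cong) auto
  finally show ?thesis by (rule power2_eq_imp_eq) auto
qed

lemma restrict_cols_mult_vec:
  assumes A: "A \<in> carrier_mat m n" and C: "col_selection k n C" and y: "y \<in> carrier_vec k"
  shows "restrict_cols A C *\<^sub>v y = A *\<^sub>v scatter_vec n C y"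
proof (rule eq_vecI)
  have len: "length C = k" and sub: "set C \<subseteq> {..<n}"
    using C by (auto simp: col_selection_def)
  fix a assume "a < dim_vec (A *\<^sub>v scatter_vec n C y)"
  hence a: "a < m" using A by simp
  have "(A *\<^sub>v scatter_vec n C y) $ a = (\<Sum>i<n. \<Sum>j<k. if C ! j = i then A $$ (a, i) * y $ j else 0)"
    using a A by (simp add: scalar_prod_def scatter_vec_def len atLeast0LessThan sum_distrib_left
        if_distrib[of "\<lambda>x. _ * x"] cong: if_cong)
  also have "\<dots> = (\<Sum>j<k. \<Sum>i<n. if C ! j = i then A $$ (a, i) * y $ j else 0)"
    by (rule sum.swap)
  also have "\<dots> = (\<Sum>j<k. A $$ (a, C ! j) * y $ j)"
  proof (intro sum.cong refl)
    fix j assume "j \<in> {..<k}"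
    hence "C ! j < n" using sub len by (auto dest: nth_mem)
    thus "(\<Sum>i<n. if C ! j = i then A $$ (a, i) * y $ j else 0) = A $$ (a, C ! j) * y $ j"
      by simp
  qed
  also have "\<dots> = (restrict_cols A C *\<^sub>v y) $ a"
    using a A y by (simp add: scalar_prod_def restrict_cols_def len atLeast0LessThan)
  finally show "(restrict_cols A C *\<^sub>v y) $ a = (A *\<^sub>v scatter_vec n C y) $ a" ..
qed (use A in \<open>simp add: restrict_cols_def\<close>)

text \<open>
  Put \<open>D = Z M\<close> with \<open>M\<close> the sampled rows of \<open>A\<close>. On a vector \<open>v\<close> the error is \<open>A w\<close>, where \<open>w\<close> is \<open>v\<close>
  minus the scattered \<open>D v\<close>, and \<open>\<parallel>w\<parallel> \<le> 1 + c\<close> because \<open>\<parallel>D\<parallel> \<le> c\<close>. The sampled entries of \<open>A w\<close> are the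
  error of the column selection within \<open>M\<close>, hence at most \<open>c \<sigma>\<^sub>k\<^sub>+\<^sub>1 M \<le> c \<surd>p \<epsilon>\<close>. Writing
  \<open>A w = X u + f\<close> with \<open>u = T w\<close> and \<open>\<parallel>f\<parallel> \<le> (1 + c) \<epsilon>\<close>, the sampled entries of \<open>X u\<close> are small as well;
  since sampling does not shrink \<open>X u\<close> by more than \<open>\<surd>\<beta>\<close>, the vector \<open>u\<close> itself is small, and with
  it the whole of \<open>A w\<close>.
\<close>

theorem skeleton_error:
  fixes A X T :: "complex mat"
  assumes A: "A \<in> carrier_mat m n" and X: "X \<in> carrier_mat m k" "mat_adjoint X * X = 1\<^sub>m k"
    and T: "T \<in> carrier_mat k n"
    and approx: "\<And>v. v \<in> carrier_vec n \<Longrightarrow>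
          l2_norm_vec (A *\<^sub>v v - X *\<^sub>v (T *\<^sub>v v)) \<le> \<epsilon> * l2_norm_vec v"
    and \<epsilon>: "0 \<le> \<epsilon>"
    and R: "R \<in> words {..<m} l"
    and mult: "\<And>r. r < m \<Longrightarrow> real (count_list R r) \<le> p" and p: "0 \<le> p"
    and lower: "\<And>u. u \<in> carrier_vec k \<Longrightarrow>
          \<beta> * (l2_norm_vec u)\<^sup>2 \<le> (l2_norm_vec (sample_vec R (X *\<^sub>v u)))\<^sup>2"
    and \<beta>: "0 < \<beta>"
    and rrqr: "rrqr_cols k (restrict_rows A R) C"
  defines "c \<equiv> sqrt (1 + 2 * real k * (real n - real k))"
  shows "spectral_norm (A - skeleton A C (pinv (restrict_cols (restrict_rows A R) C)) R)
         \<le> (1 + 2 * c) * (sqrt (p / \<beta>) * \<epsilon>) + (1 + c) * \<epsilon>"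
proof -
  define M where "M = restrict_rows A R"
  define M' where "M' = restrict_cols M C"
  define Z where "Z = pinv M'"
  define D where "D = Z * M"
  have lR: "length R = l" using R by (simp add: words_def)
  have M: "M \<in> carrier_mat l n" using A lR by (simp add: M_def restrict_rows_def)
  have C: "col_selection k n C" and err: "spectral_norm (M - M' * D) \<le> c * sing_val (k + 1) M"
    and D_norm: "spectral_norm D \<le> c"
    using rrqr M unfolding rrqr_cols_def Let_def M_def[symmetric] M'_def[symmetric]
      Z_def[symmetric] D_def[symmetric] c_def by auto
  have kn: "k \<le> n"
  proof -
    have "card (set C) \<le> card {..<n}"
      using C by (intro card_mono) (auto simp: col_selection_def)
    thus ?thesis using C by (simp add: col_selection_def distinct_card)
  qed
  have c0: "0 \<le> c" using kn by (simp add: c_def)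
  have lC: "length C = k" using C by (simp add: col_selection_def)
  have M': "M' \<in> carrier_mat l k" using M lC by (simp add: M'_def restrict_cols_def)
  have Z: "Z \<in> carrier_mat k l" using is_pinv_pinv[of M'] M' by (auto simp: Z_def is_pinv_def)
  have D: "D \<in> carrier_mat k n" using Z M by (simp add: D_def)
  have AC: "restrict_cols A C \<in> carrier_mat m k" using A lC by (simp add: restrict_cols_def)
  have Mv: "M *\<^sub>v v = sample_vec R (A *\<^sub>v v)" if "v \<in> carrier_vec n" for v
    unfolding M_def by (rule restrict_rows_mult_vec[OF A R that])
  have sample: "l2_norm_vec (sample_vec R g) \<le> sqrt p * l2_norm_vec g" if "g \<in> carrier_vec m" for g
    by (rule sample_vec_norm_le[OF R that mult])
  have sv: "sing_val (k + 1) M \<le> sqrt p * \<epsilon>"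
  proof (rule sing_val_le[OF M T])
    show "0 \<le> sqrt p * \<epsilon>" using p \<epsilon> by simp
    fix v assume v: "v \<in> carrier_vec n" and Tv: "T *\<^sub>v v = 0\<^sub>v k"
    have Av: "A *\<^sub>v v \<in> carrier_vec m" using A v by simp
    have "X *\<^sub>v (T *\<^sub>v v) = 0\<^sub>v m" using Tv X by auto
    hence "A *\<^sub>v v - X *\<^sub>v (T *\<^sub>v v) = A *\<^sub>v v" using Av by simp
    hence "l2_norm_vec (A *\<^sub>v v) \<le> \<epsilon> * l2_norm_vec v" using approx[OF v] by simp
    hence "sqrt p * l2_norm_vec (A *\<^sub>v v) \<le> sqrt p * (\<epsilon> * l2_norm_vec v)"
      using p by (intro mult_left_mono) auto
    thus "l2_norm_vec (M *\<^sub>v v) \<le> sqrt p * \<epsilon> * l2_norm_vec v"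
      unfolding Mv[OF v] using sample[OF Av] by simp
  qed
  have skel: "skeleton A C Z R = restrict_cols A C * D"
    unfolding skeleton_def D_def M_def[symmetric] by (rule assoc_mult_mat[OF AC Z M])
  have "spectral_norm (A - restrict_cols A C * D) \<le> (1 + 2 * c) * (sqrt (p / \<beta>) * \<epsilon>) + (1 + c) * \<epsilon>"
  proof (rule spectral_norm_leI)
    show "A - restrict_cols A C * D \<in> carrier_mat m n" using A AC D by auto
    fix v :: "complex Matrix.vec" assume v: "v \<in> carrier_vec n" and v1: "l2_norm_vec v \<le> 1"
    define y where "y = D *\<^sub>v v"
    define w where "w = v - scatter_vec n C y"
    have y: "y \<in> carrier_vec k" using D v by (simp add: y_def)
    have w: "w \<in> carrier_vec n" using v by (simp add: w_def)
    have y_norm: "l2_norm_vec y \<le> c"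
    proof -
      have "l2_norm_vec y \<le> spectral_norm D * l2_norm_vec v"
        unfolding y_def by (rule mult_mat_vec_norm_le[OF D v])
      also have "\<dots> \<le> c * 1" using D_norm v1 c0 by (intro mult_mono) auto
      finally show ?thesis by simp
    qed
    have w_norm: "l2_norm_vec w \<le> 1 + c"
      using l2_norm_vec_diff[OF v scatter_vec_carrier, of C y] scatter_vec_norm[OF C y] v1 y_norm
      by (simp add: w_def)
    have residual: "(B - restrict_cols B C * D) *\<^sub>v v = B *\<^sub>v w" if B: "B \<in> carrier_mat a n" for B a
    proof -
      have BC: "restrict_cols B C \<in> carrier_mat a k" using B lC by (simp add: restrict_cols_def)
      have "(B - restrict_cols B C * D) *\<^sub>v v = B *\<^sub>v v - (restrict_cols B C * D) *\<^sub>v v"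
        using B BC D v by (intro minus_mult_distrib_mat_vec) auto
      also have "(restrict_cols B C * D) *\<^sub>v v = B *\<^sub>v scatter_vec n C y"
        using restrict_cols_mult_vec[OF B C y] assoc_mult_mat_vec[OF BC D v] by (simp add: y_def)
      also have "B *\<^sub>v v - B *\<^sub>v scatter_vec n C y = B *\<^sub>v w"
        unfolding w_def by (rule mult_minus_distrib_mat_vec[OF B v scatter_vec_carrier, symmetric])
      finally show ?thesis .
    qed
    have Aw: "A *\<^sub>v w \<in> carrier_vec m" using A w by simp
    define u where "u = T *\<^sub>v w"
    have u: "u \<in> carrier_vec k" using T w by (simp add: u_def)
    have Xu: "X *\<^sub>v u \<in> carrier_vec m" using X u by simp
    define f where "f = A *\<^sub>v w - X *\<^sub>v u"
    have f: "f \<in> carrier_vec m" using Aw Xu by (simp add: f_def)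
    have f_norm: "l2_norm_vec f \<le> (1 + c) * \<epsilon>"
    proof -
      have "l2_norm_vec f \<le> \<epsilon> * l2_norm_vec w" unfolding f_def u_def by (rule approx[OF w])
      also have "\<dots> \<le> \<epsilon> * (1 + c)" using w_norm \<epsilon> by (rule mult_left_mono)
      finally show ?thesis by (simp add: mult.commute)
    qed
    have sampled: "l2_norm_vec (sample_vec R (A *\<^sub>v w)) \<le> c * (sqrt p * \<epsilon>)"
    proof -
      have MD: "M - M' * D \<in> carrier_mat l n" using M M' D by auto
      have "sample_vec R (A *\<^sub>v w) = (M - M' * D) *\<^sub>v v"
        using residual[OF M] Mv[OF w] by (simp add: M'_def)
      hence "l2_norm_vec (sample_vec R (A *\<^sub>v w)) \<le> spectral_norm (M - M' * D) * l2_norm_vec v"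
        using mult_mat_vec_norm_le[OF MD v] by simp
      also have "\<dots> \<le> spectral_norm (M - M' * D) * 1"
        using v1 spectral_norm_nonneg by (intro mult_left_mono) auto
      also have "\<dots> \<le> c * (sqrt p * \<epsilon>)" using err mult_left_mono[OF sv c0] by simp
      finally show ?thesis .
    qed
    have "sample_vec R (X *\<^sub>v u) = sample_vec R (A *\<^sub>v w) - sample_vec R f"
    proof -
      have "X *\<^sub>v u = A *\<^sub>v w - f" using A X by (intro eq_vecI) (auto simp: f_def simp del: index_mult_mat_vec)
      thus ?thesis using sample_vec_diff[OF R Aw f] by simp
    qed
    hence "l2_norm_vec (sample_vec R (X *\<^sub>v u)) \<le> l2_norm_vec (sample_vec R (A *\<^sub>v w)) + l2_norm_vec (sample_vec R f)"
      using l2_norm_vec_diff[of "sample_vec R (A *\<^sub>v w)" l "sample_vec R f"] R by simp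
    also have "\<dots> \<le> c * (sqrt p * \<epsilon>) + sqrt p * ((1 + c) * \<epsilon>)"
      using sampled sample[OF f] mult_left_mono[OF f_norm, of "sqrt p"] p by simp
    also have "\<dots> = (1 + 2 * c) * (sqrt p * \<epsilon>)" by (simp add: algebra_simps)
    finally have s: "l2_norm_vec (sample_vec R (X *\<^sub>v u)) \<le> (1 + 2 * c) * (sqrt p * \<epsilon>)" .
    have "sqrt (\<beta> * (l2_norm_vec u)\<^sup>2) \<le> sqrt ((l2_norm_vec (sample_vec R (X *\<^sub>v u)))\<^sup>2)"
      by (rule real_sqrt_le_mono[OF lower[OF u]])
    hence "sqrt \<beta> * l2_norm_vec u \<le> (1 + 2 * c) * (sqrt p * \<epsilon>)"
      using s by (simp add: real_sqrt_mult)
    hence u_norm: "l2_norm_vec u \<le> (1 + 2 * c) * (sqrt (p / \<beta>) * \<epsilon>)"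
      using \<beta> by (simp add: real_sqrt_divide field_simps)
    have "A *\<^sub>v w = X *\<^sub>v u + f" using A X by (intro eq_vecI) (auto simp: f_def simp del: index_mult_mat_vec)
    hence "l2_norm_vec (A *\<^sub>v w) \<le> l2_norm_vec (X *\<^sub>v u) + l2_norm_vec f"
      using l2_norm_vec_add[OF Xu f] by simp
    also have "l2_norm_vec (X *\<^sub>v u) = l2_norm_vec u" by (rule isometry_norm[OF X u])
    finally show "l2_norm_vec ((A - restrict_cols A C * D) *\<^sub>v v)
        \<le> (1 + 2 * c) * (sqrt (p / \<beta>) * \<epsilon>) + (1 + c) * \<epsilon>"
      unfolding residual[OF A] using u_norm f_norm by linarith
  qed
  thus ?thesis by (simp add: skel[symmetric] Z_def M'_def M_def)
qed

lemma replicate_pmf_uniform: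
  assumes "finite A" "A \<noteq> {}"
  shows "replicate_pmf l (pmf_of_set A) = pmf_of_set (words A l)"
proof (induction l)
  case 0
  show ?case by (simp add: pmf_of_set_singleton)
next
  case (Suc l)
  have ne: "words A l \<noteq> {}" "words A (Suc l) \<noteq> {}"
    using assms card_words[of A l] card_words[of A "Suc l"] by auto
  have bij: "bij_betw (\<lambda>(x, xs). x # xs) (A \<times> words A l) (words A (Suc l))"
    by (rule bij_betwI[of _ _ _ "\<lambda>w. (hd w, tl w)"]) (auto simp: words_def length_Suc_conv)
  have "replicate_pmf (Suc l) (pmf_of_set A)
      = map_pmf (\<lambda>(x, xs). x # xs) (pair_pmf (pmf_of_set A) (pmf_of_set (words A l)))"
    by (simp add: Suc.IH pair_pmf_def map_pmf_def bind_assoc_pmf bind_return_pmf)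
  also have "pair_pmf (pmf_of_set A) (pmf_of_set (words A l)) = pmf_of_set (A \<times> words A l)"
  proof (rule pmf_eqI)
    fix x show "pmf (pair_pmf (pmf_of_set A) (pmf_of_set (words A l))) x = pmf (pmf_of_set (A \<times> words A l)) x"
      using assms ne by (cases x) (simp add: pmf_pair card_cartesian_product indicator_def)
  qed
  also have "map_pmf (\<lambda>(x, xs). x # xs) \<dots> = pmf_of_set (words A (Suc l))"
    using bij assms ne by (intro map_pmf_of_set_bij_betw) auto
  finally show ?case .
qed

section \<open>Probability of success\<close>

lemma adjoint_append_cols:
  assumes "X \<in> carrier_mat m a" "Y \<in> carrier_mat m b"
  shows "mat_adjoint (X @\<^sub>c Y) = mat_adjoint X @\<^sub>r mat_adjoint Y"
  by (rule eq_matI) (use assms in \<open>auto simp: append_cols_def append_rows_def\<close>)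

lemma leading_block_product:
  fixes X\<^sub>1 X\<^sub>2 A\<^sub>1\<^sub>1 Y\<^sub>1 Y\<^sub>2 :: "complex mat"
  assumes X: "X\<^sub>1 \<in> carrier_mat m k" "X\<^sub>2 \<in> carrier_mat m a"
    and A: "A\<^sub>1\<^sub>1 \<in> carrier_mat k k"
    and Y: "Y\<^sub>1 \<in> carrier_mat k n" "Y\<^sub>2 \<in> carrier_mat b n"
  shows "(X\<^sub>1 @\<^sub>c X\<^sub>2) * four_block_mat A\<^sub>1\<^sub>1 (0\<^sub>m k b) (0\<^sub>m a k) (0\<^sub>m a b) * (Y\<^sub>1 @\<^sub>r Y\<^sub>2)
       = X\<^sub>1 * A\<^sub>1\<^sub>1 * Y\<^sub>1"
proof -
  have "(X\<^sub>1 @\<^sub>c X\<^sub>2) * four_block_mat A\<^sub>1\<^sub>1 (0\<^sub>m k b) (0\<^sub>m a k) (0\<^sub>m a b)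
      = four_block_mat (X\<^sub>1 * A\<^sub>1\<^sub>1) (0\<^sub>m m b) (0\<^sub>m 0 k) (0\<^sub>m 0 b)"
    unfolding append_cols_def using X A
    by (subst mult_four_block_mat[of _ m k _ a _ 0 _ _ k _ b]) auto
  also have "\<dots> * (Y\<^sub>1 @\<^sub>r Y\<^sub>2)
      = four_block_mat (X\<^sub>1 * A\<^sub>1\<^sub>1 * Y\<^sub>1) (0\<^sub>m m 0) (0\<^sub>m 0 n) (0\<^sub>m 0 0)"
    unfolding append_rows_def using X A Y
    by (subst mult_four_block_mat[of _ m k _ b _ 0 _ _ n _ 0]) auto
  also have "\<dots> = X\<^sub>1 * A\<^sub>1\<^sub>1 * Y\<^sub>1"
    by (rule eq_matI) (use X A Y in auto)
  finally show ?thesis .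
qed

text \<open>
  \<open>A\<close> differs from \<open>X\<^sub>1 A\<^sub>1\<^sub>1 Y\<^sub>1\<^sup>*\<close> by \<open>X E Y\<^sup>*\<close>, where \<open>E\<close> is the block matrix whose norm is \<open>\<epsilon>\<^sub>k\<close> and
  \<open>X\<close>, \<open>Y\<close> are unitary.
\<close>

lemma leading_block_residual:
  fixes A\<^sub>1\<^sub>1 A\<^sub>1\<^sub>2 A\<^sub>2\<^sub>1 A\<^sub>2\<^sub>2 X\<^sub>1 X\<^sub>2 Y\<^sub>1 Y\<^sub>2 :: "complex mat"
  assumes kn: "k \<le> n" "k \<le> m"
    and B: "A\<^sub>1\<^sub>1 \<in> carrier_mat k k" "A\<^sub>1\<^sub>2 \<in> carrier_mat k (n - k)"
      "A\<^sub>2\<^sub>1 \<in> carrier_mat (m - k) k" "A\<^sub>2\<^sub>2 \<in> carrier_mat (m - k) (n - k)"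
    and X: "X\<^sub>1 \<in> carrier_mat m k" "X\<^sub>2 \<in> carrier_mat m (m - k)" "unitary_mat m (X\<^sub>1 @\<^sub>c X\<^sub>2)"
    and Y: "Y\<^sub>1 \<in> carrier_mat n k" "Y\<^sub>2 \<in> carrier_mat n (n - k)" "unitary_mat n (Y\<^sub>1 @\<^sub>c Y\<^sub>2)"
    and A: "A = (X\<^sub>1 @\<^sub>c X\<^sub>2) * four_block_mat A\<^sub>1\<^sub>1 A\<^sub>1\<^sub>2 A\<^sub>2\<^sub>1 A\<^sub>2\<^sub>2
           * (mat_adjoint Y\<^sub>1 @\<^sub>r mat_adjoint Y\<^sub>2)"
    and v: "v \<in> carrier_vec n"
  shows "l2_norm_vec (A *\<^sub>v v - X\<^sub>1 *\<^sub>v ((A\<^sub>1\<^sub>1 * mat_adjoint Y\<^sub>1) *\<^sub>v v))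
       \<le> spectral_norm (four_block_mat (0\<^sub>m k k) A\<^sub>1\<^sub>2 A\<^sub>2\<^sub>1 A\<^sub>2\<^sub>2) * l2_norm_vec v"
proof -
  define P where "P = X\<^sub>1 @\<^sub>c X\<^sub>2"
  define W where "W = mat_adjoint Y\<^sub>1 @\<^sub>r mat_adjoint Y\<^sub>2"
  define E where "E = four_block_mat (0\<^sub>m k k) A\<^sub>1\<^sub>2 A\<^sub>2\<^sub>1 A\<^sub>2\<^sub>2"
  define E0 where "E0 = four_block_mat A\<^sub>1\<^sub>1 (0\<^sub>m k (n - k)) (0\<^sub>m (m - k) k) (0\<^sub>m (m - k) (n - k))"
  have P: "P \<in> carrier_mat m m" "mat_adjoint P * P = 1\<^sub>m m"
    using X by (auto simp: P_def unitary_mat_def)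
  have WY: "W = mat_adjoint (Y\<^sub>1 @\<^sub>c Y\<^sub>2)"
    unfolding W_def using adjoint_append_cols[OF Y(1,2)] by simp
  have W: "W \<in> carrier_mat n n" "mat_adjoint W * W = 1\<^sub>m n"
    using Y(3) by (auto simp: WY unitary_mat_def)
  have E: "E \<in> carrier_mat m n" "E0 \<in> carrier_mat m n"
    using B kn by (auto simp: E_def E0_def intro!: carrier_matI)
  have "four_block_mat A\<^sub>1\<^sub>1 A\<^sub>1\<^sub>2 A\<^sub>2\<^sub>1 A\<^sub>2\<^sub>2 = E + E0"
    unfolding E_def E0_def using B
    by (subst add_four_block_mat[of _ k k _ "n - k" _ "m - k"]) auto
  hence "A = P * (E + E0) * W" using A by (simp add: P_def W_def)
  also have "\<dots> = P * E * W + P * E0 * W"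
    using P W E by (simp add: mult_add_distrib_mat[of _ m m] add_mult_distrib_mat[of _ m n])
  also have "P * E0 * W = X\<^sub>1 * (A\<^sub>1\<^sub>1 * mat_adjoint Y\<^sub>1)"
  proof -
    have Ya: "mat_adjoint Y\<^sub>1 \<in> carrier_mat k n" "mat_adjoint Y\<^sub>2 \<in> carrier_mat (n - k) n"
      using Y by auto
    have "P * E0 * W = X\<^sub>1 * A\<^sub>1\<^sub>1 * mat_adjoint Y\<^sub>1"
      unfolding P_def E0_def W_def by (rule leading_block_product[OF X(1,2) B(1) Ya])
    thus ?thesis using assoc_mult_mat[OF X(1) B(1) Ya(1)] by simp
  qed
  finally have A': "A = P * E * W + X\<^sub>1 * (A\<^sub>1\<^sub>1 * mat_adjoint Y\<^sub>1)" .
  have T: "A\<^sub>1\<^sub>1 * mat_adjoint Y\<^sub>1 \<in> carrier_mat k n" using B Y by auto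
  have PEW: "P * E * W \<in> carrier_mat m n" using P E W by simp
  define x where "x = P * E * W *\<^sub>v v"
  define y where "y = X\<^sub>1 *\<^sub>v ((A\<^sub>1\<^sub>1 * mat_adjoint Y\<^sub>1) *\<^sub>v v)"
  have xy: "x \<in> carrier_vec m" "y \<in> carrier_vec m"
    using PEW v X(1) T by (auto simp: x_def y_def intro!: mult_mat_vec_carrier)
  have "A *\<^sub>v v = x + y"
    unfolding A' x_def y_def using PEW X(1) T v
    by (simp add: add_mult_distrib_mat_vec[of _ m n] assoc_mult_mat_vec[of _ m k _ n])
  hence "A *\<^sub>v v - y = x" using xy by (intro eq_vecI) auto
  moreover have "x = P *\<^sub>v (E *\<^sub>v (W *\<^sub>v v))"
    unfolding x_def using P E W v
    by (simp add: assoc_mult_mat_vec[of _ m n _ n] assoc_mult_mat_vec[of _ m m _ n] mult_carrier_mat[of _ m m])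
  moreover have "l2_norm_vec (P *\<^sub>v (E *\<^sub>v (W *\<^sub>v v))) = l2_norm_vec (E *\<^sub>v (W *\<^sub>v v))"
    using E W v by (intro isometry_norm[OF P]) auto
  moreover have "l2_norm_vec (E *\<^sub>v (W *\<^sub>v v)) \<le> spectral_norm E * l2_norm_vec (W *\<^sub>v v)"
    using E W v by (intro mult_mat_vec_norm_le) auto
  moreover have "l2_norm_vec (W *\<^sub>v v) = l2_norm_vec v"
    by (rule isometry_norm[OF W v])
  ultimately show ?thesis by (simp add: y_def E_def)
qed

text \<open>
  A column has unit norm and \<open>m\<close> entries of modulus at most \<open>\<surd>(\<mu> / m)\<close>, whence \<open>1 \<le> \<mu>\<close>.
\<close>

lemma coherent_row_bound:
  assumes "coherent \<mu> X" "X \<in> carrier_mat m k" "0 < k" "0 < m"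
  shows "1 \<le> \<mu>" and "a < m \<Longrightarrow> (\<Sum>j<k. (cmod (X $$ (a, j)))\<^sup>2) \<le> real k * \<mu> / real m"
proof -
  have entry: "(cmod (X $$ (a, j)))\<^sup>2 \<le> \<mu> / real m" if "a < m" "j < k" for a j
  proof -
    have le: "cmod (X $$ (a, j)) \<le> sqrt (\<mu> / real m)"
      using assms(1,2) that by (auto simp: coherent_def)
    hence "0 \<le> sqrt (\<mu> / real m)" using norm_ge_zero order_trans by blast
    hence "0 \<le> \<mu> / real m" by (simp only: real_sqrt_ge_0_iff)
    thus ?thesis using power_mono[OF le, of 2] by simp
  qed
  have "l2_norm_vec (X *\<^sub>v unit_vec k 0) = 1"
    using isometry_norm[OF assms(2), of "unit_vec k 0"] assms by (simp add: coherent_def)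
  hence "1 = (\<Sum>a<m. (cmod (X $$ (a, 0)))\<^sup>2)"
    using assms l2_norm_vec_sq[of "X *\<^sub>v unit_vec k 0" m] by (simp add: scalar_prod_right_unit)
  also have "\<dots> \<le> (\<Sum>a<m. \<mu> / real m)"
    using entry assms(3) by (intro sum_mono) auto
  finally show "1 \<le> \<mu>" using assms(4) by simp
  show "(\<Sum>j<k. (cmod (X $$ (a, j)))\<^sup>2) \<le> real k * \<mu> / real m" if "a < m"
  proof -
    have "(\<Sum>j<k. (cmod (X $$ (a, j)))\<^sup>2) \<le> (\<Sum>j<k. \<mu> / real m)"
      using entry that by (intro sum_mono) auto
    thus ?thesis by simp
  qed
qed

lemma sampled_lower_bound_scale:
  assumes R: "R \<in> words {..<m} l" and X: "X \<in> carrier_mat m k"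
    and unit: "\<And>u. u \<in> carrier_vec k \<Longrightarrow> l2_norm_vec u = 1 \<Longrightarrow>
        \<beta> \<le> (l2_norm_vec (sample_vec R (X *\<^sub>v u)))\<^sup>2"
    and u: "u \<in> carrier_vec k"
  shows "\<beta> * (l2_norm_vec u)\<^sup>2 \<le> (l2_norm_vec (sample_vec R (X *\<^sub>v u)))\<^sup>2"
proof (cases "l2_norm_vec u = 0")
  case False
  hence pos: "0 < l2_norm_vec u" using l2_norm_vec_nonneg[of u] by linarith
  define a where "a = complex_of_real (1 / l2_norm_vec u)"
  have "sample_vec R (X *\<^sub>v (a \<cdot>\<^sub>v u)) = a \<cdot>\<^sub>v sample_vec R (X *\<^sub>v u)"
  proof -
    have "X *\<^sub>v (a \<cdot>\<^sub>v u) = a \<cdot>\<^sub>v (X *\<^sub>v u)" by (rule mult_mat_vec[OF X u])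
    moreover have "R ! i < m" if "i < length R" for i
      using R that by (auto simp: words_def dest: nth_mem)
    ultimately show ?thesis
      using X by (intro eq_vecI) (auto simp: sample_vec_def simp del: index_mult_mat_vec)
  qed
  moreover have "\<beta> \<le> (l2_norm_vec (sample_vec R (X *\<^sub>v (a \<cdot>\<^sub>v u))))\<^sup>2"
    using u pos by (intro unit) (auto simp: l2_norm_vec_smult a_def norm_divide)
  ultimately have "\<beta> \<le> (1 / l2_norm_vec u * l2_norm_vec (sample_vec R (X *\<^sub>v u)))\<^sup>2"
    by (simp add: l2_norm_vec_smult a_def norm_divide)
  thus ?thesis using pos by (simp add: power_divide field_simps)
qed simp

text \<open>
  The bound of \<open>skeleton_error\<close> for \<open>p = 3 l / k\<close> and \<open>\<beta> = l / (10 m)\<close>: then \<open>p / \<beta> = 30 m / k\<close>, and the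
  factor \<open>c\<close>, of order \<open>\<surd>(k n)\<close>, combines with \<open>\<surd>(m / k)\<close> to \<open>\<surd>(m n)\<close>. The numbers \<open>7 / 4\<close> and
  \<open>11 / 2\<close> are upper bounds for \<open>\<surd>3\<close> and \<open>\<surd>30\<close>.
\<close>

lemma error_constant:
  fixes m n k l :: nat
  assumes "0 < k" "k \<le> n" "n \<le> m" "0 < l" "0 \<le> \<epsilon>"
  defines "c \<equiv> sqrt (1 + 2 * real k * (real n - real k))"
  shows "(1 + 2 * c) * (sqrt ((3 * real l / real k) / (real l / (10 * real m))) * \<epsilon>) + (1 + c) * \<epsilon>
       \<le> 30 * (\<epsilon> * sqrt (real m * real n))"
proof -
  define s where "s = sqrt (real k * real n)"
  define r where "r = sqrt (real m / real k)"
  have k1: "1 \<le> real k" "1 \<le> real n" using assms(1,2) by simp_all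
  have kn1: "1 \<le> real k * real n" using mult_mono[OF k1] by simp
  hence s1: "1 \<le> s" by (simp add: s_def)
  have kk: "1 \<le> real k * real k" using mult_mono[OF k1(1) k1(1)] by simp
  have "1 + 2 * real k * (real n - real k) \<le> 3 * (real k * real n)"
    using kn1 kk by (simp add: algebra_simps)
  also have "\<dots> \<le> (7 / 4 * s)\<^sup>2"
    using kn1 by (simp add: s_def power_mult_distrib power2_eq_square)
  finally have "c \<le> sqrt ((7 / 4 * s)\<^sup>2)"
    unfolding c_def by (rule real_sqrt_le_mono)
  hence c: "c \<le> 7 / 4 * s" using s1 by simp
  have "sqrt ((3 * real l / real k) / (real l / (10 * real m))) = sqrt (30 * (real m / real k))"
    using assms(4) by (simp add: field_simps)
  also have "\<dots> \<le> sqrt ((11 / 2)\<^sup>2 * (real m / real k))"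
    by (intro real_sqrt_le_mono mult_right_mono) (auto simp: power2_eq_square)
  also have "\<dots> = 11 / 2 * r" unfolding real_sqrt_mult by (simp add: r_def)
  finally have q: "sqrt ((3 * real l / real k) / (real l / (10 * real m))) \<le> 11 / 2 * r" .
  have r0: "0 \<le> r" by (simp add: r_def)
  have sr: "s * r = sqrt (real m * real n)"
    using assms(1) by (simp add: s_def r_def flip: real_sqrt_mult)
  have "s \<le> sqrt (real m * real n)"
    unfolding s_def using assms(2,3) by (intro real_sqrt_le_mono mult_right_mono) auto
  hence "(1 + c) * \<epsilon> \<le> (11 / 4 * sqrt (real m * real n)) * \<epsilon>"
    using c s1 assms(5) by (intro mult_right_mono) auto
  hence b1: "(1 + c) * \<epsilon> \<le> 11 / 4 * (\<epsilon> * sqrt (real m * real n))"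
    by (simp only: mult_ac)
  have "(1 + 2 * c) * (sqrt ((3 * real l / real k) / (real l / (10 * real m))) * \<epsilon>)
      \<le> (9 / 2 * s) * (11 / 2 * r * \<epsilon>)"
    using c s1 q r0 assms(5) by (intro mult_mono mult_right_mono) auto
  also have "\<dots> = 99 / 4 * (\<epsilon> * (s * r))" by simp
  finally have b2: "(1 + 2 * c) * (sqrt ((3 * real l / real k) / (real l / (10 * real m))) * \<epsilon>)
      \<le> 99 / 4 * (\<epsilon> * sqrt (real m * real n))"
    unfolding sr .
  have "0 \<le> \<epsilon> * sqrt (real m * real n)" using assms(5) by simp
  with b1 b2 show ?thesis by linarith
qed

text \<open>
  Both kinds of failure are rare because \<open>l / k \<ge> l / (k \<mu>) \<ge> 10 ln m\<close>. For the lower tail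
  \<open>1 / 3 \<le> exp (-1)\<close> leaves an exponent of at least \<open>2 ln m\<close>; for the multiplicities the
  exponent \<open>10 ln m\<close> also pays for the factor \<open>m\<close>.
\<close>

lemma failure_exponents:
  fixes m k l :: nat
  assumes m: "2 \<le> m" and k: "0 < k" "k \<le> m" and \<mu>: "1 \<le> \<mu>"
    and l: "10 * \<mu> * real k * ln (real m) \<le> real l"
  shows "exp (- (real l / (real k * \<mu>)) * (exp (-1) - 1 / 10)) \<le> 1 / real m ^ 2"
    and "real m * exp (2 * real l / real m - 3 * real l / real k) \<le> 1 / real m ^ 2"
proof -
  have L: "0 < ln (real m)" using m by simp
  have inv_sq: "exp (- 2 * ln (real m)) = 1 / real m ^ 2"
  proof -
    have "exp (- 2 * ln (real m)) = inverse (exp (real 2 * ln (real m)))"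
      by (simp add: exp_minus)
    also have "exp (real 2 * ln (real m)) = real m ^ 2"
      unfolding exp_of_nat_mult using m by simp
    finally show ?thesis by (simp add: inverse_eq_divide)
  qed
  have "1 / 3 \<le> exp (-1 :: real)"
    using exp_le by (simp add: exp_minus field_simps)
  hence e: "1 / 5 \<le> exp (-1 :: real) - 1 / 10" by simp
  have lK: "10 * ln (real m) \<le> real l / (real k * \<mu>)"
    using l k \<mu> by (simp add: field_simps)
  have "(10 * ln (real m)) * (1 / 5) \<le> (real l / (real k * \<mu>)) * (exp (-1) - 1 / 10)"
    using lK e L \<mu> by (intro mult_mono) auto
  hence "exp (- (real l / (real k * \<mu>)) * (exp (-1) - 1 / 10)) \<le> exp (- 2 * ln (real m))"
    by simp
  thus "exp (- (real l / (real k * \<mu>)) * (exp (-1) - 1 / 10)) \<le> 1 / real m ^ 2"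
    unfolding inv_sq .
  have "10 * ln (real m) \<le> real l / real k"
  proof -
    have "10 * real k * ln (real m) * 1 \<le> 10 * real k * ln (real m) * \<mu>"
      using \<mu> L by (intro mult_left_mono) auto
    hence "10 * real k * ln (real m) \<le> real l" using l by (simp add: mult_ac)
    thus ?thesis using k by (simp add: field_simps)
  qed
  moreover have "real l / real m \<le> real l / real k"
    using k by (intro divide_left_mono) auto
  ultimately have "ln (real m) + (2 * real l / real m - 3 * real l / real k) \<le> - 2 * ln (real m)"
    using L by simp
  hence "exp (ln (real m) + (2 * real l / real m - 3 * real l / real k)) \<le> exp (- 2 * ln (real m))"
    by simp
  thus "real m * exp (2 * real l / real m - 3 * real l / real k) \<le> 1 / real m ^ 2"
    unfolding inv_sq exp_add using m by simp
qed

text \<open>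
  The skeleton is good unless the sampled rows of \<open>X\<^sub>1\<close> nearly annihilate some vector (the set
  \<open>S1\<close>) or some row is drawn more than \<open>3 l / k\<close> times (the set \<open>S2\<close>). Each of these has probability
  at most \<open>k m\<^sup>-\<^sup>2\<close>.
\<close>

lemma algorithm3_success:
  fixes A\<^sub>1\<^sub>1 A\<^sub>1\<^sub>2 A\<^sub>2\<^sub>1 A\<^sub>2\<^sub>2 X\<^sub>1 X\<^sub>2 Y\<^sub>1 Y\<^sub>2 :: "complex mat"
  assumes m: "2 \<le> m" and k: "0 < k" "k \<le> n" "n \<le> m" and Ac: "A \<in> carrier_mat m n"
    and B: "A\<^sub>1\<^sub>1 \<in> carrier_mat k k" "A\<^sub>1\<^sub>2 \<in> carrier_mat k (n - k)"
      "A\<^sub>2\<^sub>1 \<in> carrier_mat (m - k) k" "A\<^sub>2\<^sub>2 \<in> carrier_mat (m - k) (n - k)"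
    and X: "X\<^sub>1 \<in> carrier_mat m k" "X\<^sub>2 \<in> carrier_mat m (m - k)" "unitary_mat m (X\<^sub>1 @\<^sub>c X\<^sub>2)"
    and Y: "Y\<^sub>1 \<in> carrier_mat n k" "Y\<^sub>2 \<in> carrier_mat n (n - k)" "unitary_mat n (Y\<^sub>1 @\<^sub>c Y\<^sub>2)"
    and A: "A = (X\<^sub>1 @\<^sub>c X\<^sub>2) * four_block_mat A\<^sub>1\<^sub>1 A\<^sub>1\<^sub>2 A\<^sub>2\<^sub>1 A\<^sub>2\<^sub>2
           * (mat_adjoint Y\<^sub>1 @\<^sub>r mat_adjoint Y\<^sub>2)"
    and \<epsilon>: "\<epsilon> = spectral_norm (four_block_mat (0\<^sub>m k k) A\<^sub>1\<^sub>2 A\<^sub>2\<^sub>1 A\<^sub>2\<^sub>2)"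
    and coh: "coherent \<mu> X\<^sub>1"
    and l: "10 * \<mu> * real k * ln (real m) \<le> real l"
    and rrqr: "strong_rrqr k rrqr"
  shows "1 - 2 * real k / real m ^ 2 \<le> measure_pmf.prob (algorithm3 rrqr l A)
       {(C', Z, R). length R = l \<and> set R \<subseteq> {..<m} \<and> col_selection k n C' \<and>
          spectral_norm (A - skeleton A C' Z R) \<le> 30 * (\<epsilon> * sqrt (real m * real n))}"
    (is "_ \<le> measure_pmf.prob _ ?Ev")
proof -
  define \<Omega> where "\<Omega> = words {..<m} l"
  define S1 where "S1 = {R \<in> \<Omega>. \<exists>u \<in> carrier_vec k. l2_norm_vec u = 1 \<and>
     (l2_norm_vec (sample_vec R (X\<^sub>1 *\<^sub>v u)))\<^sup>2 < 1 / 10 * real l / real m}"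
  define S2 where "S2 = {R \<in> \<Omega>. \<exists>r<m. 3 * real l / real k < real (count_list R r)}"
  define out where "out R = (let A\<^sub>R = restrict_rows A R; C' = rrqr A\<^sub>R;
     Z = pinv (restrict_cols A\<^sub>R C') in (C', Z, R))" for R
  have m0: "0 < m" using m by simp
  note row = coherent_row_bound[OF coh X(1) k(1) m0]
  have iso: "mat_adjoint X\<^sub>1 * X\<^sub>1 = 1\<^sub>m k" using coh X(1) by (simp add: coherent_def)
  have "0 < 10 * \<mu> * real k * ln (real m)" using row(1) k(1) m by simp
  hence l0: "0 < l" using l by linarith
  have \<epsilon>0: "0 \<le> \<epsilon>" unfolding \<epsilon> by (rule spectral_norm_nonneg)
  have fin: "finite \<Omega>" by (simp add: \<Omega>_def)
  have card\<Omega>: "real (card \<Omega>) = real m ^ l" by (simp add: \<Omega>_def card_words)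
  have ne: "\<Omega> \<noteq> {}" using card\<Omega> m0 by auto
  have T: "A\<^sub>1\<^sub>1 * mat_adjoint Y\<^sub>1 \<in> carrier_mat k n" using B Y by auto
  have good: "out R \<in> ?Ev" if R: "R \<in> \<Omega>" "R \<notin> S1" "R \<notin> S2" for R
  proof -
    define C where "C = rrqr (restrict_rows A R)"
    have Rw: "R \<in> words {..<m} l" using R by (simp add: \<Omega>_def)
    have rr: "rrqr_cols k (restrict_rows A R) C"
      using rrqr k Ac by (simp add: strong_rrqr_def C_def restrict_rows_def)
    have sel: "col_selection k n C"
      using rr Ac by (simp add: rrqr_cols_def Let_def restrict_rows_def)
    have "spectral_norm (A - skeleton A C (pinv (restrict_cols (restrict_rows A R) C)) R)
        \<le> (1 + 2 * sqrt (1 + 2 * real k * (real n - real k)))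
             * (sqrt ((3 * real l / real k) / (real l / (10 * real m))) * \<epsilon>)
           + (1 + sqrt (1 + 2 * real k * (real n - real k))) * \<epsilon>"
    proof (rule skeleton_error[OF Ac X(1) iso T _ \<epsilon>0 Rw _ _ _ _ rr])
      fix v :: "complex Matrix.vec" assume v: "v \<in> carrier_vec n"
      show "l2_norm_vec (A *\<^sub>v v - X\<^sub>1 *\<^sub>v (A\<^sub>1\<^sub>1 * mat_adjoint Y\<^sub>1 *\<^sub>v v)) \<le> \<epsilon> * l2_norm_vec v"
        unfolding \<epsilon> using k by (intro leading_block_residual[OF _ _ B X Y A v]) auto
    next
      fix r assume "r < m"
      thus "real (count_list R r) \<le> 3 * real l / real k"
        using R unfolding S2_def by (metis (mono_tags, lifting) mem_Collect_eq not_less)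
    next
      fix u :: "complex Matrix.vec" assume u: "u \<in> carrier_vec k"
      show "real l / (10 * real m) * (l2_norm_vec u)\<^sup>2 \<le> (l2_norm_vec (sample_vec R (X\<^sub>1 *\<^sub>v u)))\<^sup>2"
        by (rule sampled_lower_bound_scale[OF Rw X(1) _ u]) (use R in \<open>auto simp: S1_def not_less\<close>)
    qed (use l0 m0 in auto)
    also have "\<dots> \<le> 30 * (\<epsilon> * sqrt (real m * real n))"
      by (rule error_constant[OF k l0 \<epsilon>0])
    finally show ?thesis
      using sel Rw by (simp add: out_def Let_def C_def words_def)
  qed
  have "real (card S1) \<le> real m ^ l * (real k * exp (- (real l / (real k * \<mu>)) * (exp (-1) - 1 / 10)))"
    unfolding S1_def \<Omega>_def by (rule row_sampling_lower_tail[OF X(1) iso k(1) row(2)]) auto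
  also have "\<dots> \<le> real m ^ l * (real k * (1 / real m ^ 2))"
    using failure_exponents(1)[OF m k(1) _ row(1) l] k by (intro mult_left_mono) auto
  finally have S1: "real (card S1) \<le> real m ^ l * (real k / real m ^ 2)" by simp
  have "real (card S2) \<le> real m ^ l * (real m * exp (2 * real l / real m - 3 * real l / real k))"
    unfolding S2_def \<Omega>_def by (rule multiplicity_tail[OF m0])
  also have "\<dots> \<le> real m ^ l * (1 / real m ^ 2)"
    using failure_exponents(2)[OF m k(1) _ row(1) l] k by (intro mult_left_mono) auto
  also have "\<dots> \<le> real m ^ l * (real k / real m ^ 2)"
    using k by (intro mult_left_mono divide_right_mono) auto
  finally have S2: "real (card S2) \<le> real m ^ l * (real k / real m ^ 2)" .
  have "\<Omega> \<subseteq> (\<Omega> \<inter> out -` ?Ev) \<union> (S1 \<union> S2)"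
    using good by blast
  hence "card \<Omega> \<le> card ((\<Omega> \<inter> out -` ?Ev) \<union> (S1 \<union> S2))"
    by (rule card_mono[rotated]) (use fin in \<open>auto simp: S1_def S2_def\<close>)
  also have "\<dots> \<le> card (\<Omega> \<inter> out -` ?Ev) + (card S1 + card S2)"
    using card_Un_le[of "\<Omega> \<inter> out -` ?Ev" "S1 \<union> S2"] card_Un_le[of S1 S2] by linarith
  finally have "real m ^ l \<le> real (card (\<Omega> \<inter> out -` ?Ev)) + 2 * (real m ^ l * (real k / real m ^ 2))"
    using S1 S2 card\<Omega> by linarith
  hence "real m ^ l * (1 - 2 * real k / real m ^ 2) \<le> real (card (\<Omega> \<inter> out -` ?Ev))"
    by (simp add: algebra_simps)
  hence "1 - 2 * real k / real m ^ 2 \<le> real (card (\<Omega> \<inter> out -` ?Ev)) / real m ^ l"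
    using m0 by (simp add: pos_le_divide_eq mult.commute)
  also have "\<dots> = measure_pmf.prob (pmf_of_set \<Omega>) (out -` ?Ev)"
    using fin ne card\<Omega> by (simp add: measure_pmf_of_set)
  also have "\<dots> = measure_pmf.prob (map_pmf out (pmf_of_set \<Omega>)) ?Ev"
    by simp
  also have "map_pmf out (pmf_of_set \<Omega>) = algorithm3 rrqr l A"
  proof -
    have "replicate_pmf l (pmf_of_set {..<dim_row A}) = pmf_of_set \<Omega>"
      unfolding \<Omega>_def using Ac m0 by (subst replicate_pmf_uniform) auto
    thus ?thesis unfolding algorithm3_def out_def by simp
  qed
  finally show ?thesis .
qed

theorem theorem3p2:
  "\<exists>c > 0. \<forall>(m::nat) (n::nat) (k::nat) (l::nat) (\<mu>::real)
      (A::complex mat) A\<^sub>1\<^sub>1 A\<^sub>1\<^sub>2 A\<^sub>2\<^sub>1 A\<^sub>2\<^sub>2 X\<^sub>1 X\<^sub>2 Y\<^sub>1 Y\<^sub>2 (\<epsilon>\<^sub>k::real)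
      (rrqr :: complex mat \<Rightarrow> nat list).
     m \<ge> n \<longrightarrow> k > 0 \<longrightarrow> k \<le> n \<longrightarrow>
     A \<in> carrier_mat m n \<longrightarrow>
     A\<^sub>1\<^sub>1 \<in> carrier_mat k k \<longrightarrow> A\<^sub>1\<^sub>2 \<in> carrier_mat k (n - k) \<longrightarrow>
     A\<^sub>2\<^sub>1 \<in> carrier_mat (m - k) k \<longrightarrow> A\<^sub>2\<^sub>2 \<in> carrier_mat (m - k) (n - k) \<longrightarrow>
     X\<^sub>1 \<in> carrier_mat m k \<longrightarrow> X\<^sub>2 \<in> carrier_mat m (m - k) \<longrightarrow>
     Y\<^sub>1 \<in> carrier_mat n k \<longrightarrow> Y\<^sub>2 \<in> carrier_mat n (n - k) \<longrightarrow>
     unitary_mat m (X\<^sub>1 @\<^sub>c X\<^sub>2) \<longrightarrow> unitary_mat n (Y\<^sub>1 @\<^sub>c Y\<^sub>2) \<longrightarrow>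
     A = (X\<^sub>1 @\<^sub>c X\<^sub>2) * four_block_mat A\<^sub>1\<^sub>1 A\<^sub>1\<^sub>2 A\<^sub>2\<^sub>1 A\<^sub>2\<^sub>2
           * (mat_adjoint Y\<^sub>1 @\<^sub>r mat_adjoint Y\<^sub>2) \<longrightarrow>
     \<epsilon>\<^sub>k = spectral_norm (four_block_mat (0\<^sub>m k k) A\<^sub>1\<^sub>2 A\<^sub>2\<^sub>1 A\<^sub>2\<^sub>2) \<longrightarrow>
     coherent \<mu> X\<^sub>1 \<longrightarrow>
     real l \<ge> 10 * \<mu> * real k * ln (real m) \<longrightarrow>
     strong_rrqr k rrqr \<longrightarrow>
     measure_pmf.prob (algorithm3 rrqr l A)
       {(C', Z, R). length R = l \<and> set R \<subseteq> {..<m} \<and> col_selection k n C' \<and>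
          spectral_norm (A - skeleton A C' Z R) \<le> c * (\<epsilon>\<^sub>k * sqrt (real m * real n))}
     \<ge> 1 - 2 * real k / real m ^ 2"
proof (intro exI[of _ 30] conjI allI impI)
  fix m n k l :: nat and \<mu> \<epsilon>\<^sub>k :: real
    and A A\<^sub>1\<^sub>1 A\<^sub>1\<^sub>2 A\<^sub>2\<^sub>1 A\<^sub>2\<^sub>2 X\<^sub>1 X\<^sub>2 Y\<^sub>1 Y\<^sub>2 :: "complex mat"
    and rrqr :: "complex mat \<Rightarrow> nat list"
  assume hyps: "n \<le> m" "0 < k" "k \<le> n" "A \<in> carrier_mat m n"
    "A\<^sub>1\<^sub>1 \<in> carrier_mat k k" "A\<^sub>1\<^sub>2 \<in> carrier_mat k (n - k)"
    "A\<^sub>2\<^sub>1 \<in> carrier_mat (m - k) k" "A\<^sub>2\<^sub>2 \<in> carrier_mat (m - k) (n - k)"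
    "X\<^sub>1 \<in> carrier_mat m k" "X\<^sub>2 \<in> carrier_mat m (m - k)"
    "Y\<^sub>1 \<in> carrier_mat n k" "Y\<^sub>2 \<in> carrier_mat n (n - k)"
    "unitary_mat m (X\<^sub>1 @\<^sub>c X\<^sub>2)" "unitary_mat n (Y\<^sub>1 @\<^sub>c Y\<^sub>2)"
    "A = (X\<^sub>1 @\<^sub>c X\<^sub>2) * four_block_mat A\<^sub>1\<^sub>1 A\<^sub>1\<^sub>2 A\<^sub>2\<^sub>1 A\<^sub>2\<^sub>2
           * (mat_adjoint Y\<^sub>1 @\<^sub>r mat_adjoint Y\<^sub>2)"
    "\<epsilon>\<^sub>k = spectral_norm (four_block_mat (0\<^sub>m k k) A\<^sub>1\<^sub>2 A\<^sub>2\<^sub>1 A\<^sub>2\<^sub>2)"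
    "coherent \<mu> X\<^sub>1" "10 * \<mu> * real k * ln (real m) \<le> real l" "strong_rrqr k rrqr"
  show "1 - 2 * real k / real m ^ 2 \<le> measure_pmf.prob (algorithm3 rrqr l A)
       {(C', Z, R). length R = l \<and> set R \<subseteq> {..<m} \<and> col_selection k n C' \<and>
          spectral_norm (A - skeleton A C' Z R) \<le> 30 * (\<epsilon>\<^sub>k * sqrt (real m * real n))}"
  proof (cases "2 \<le> m")
    case True
    show ?thesis
      by (rule algorithm3_success[OF True hyps(2,3,1) hyps(4) hyps(5-8) hyps(9,10,13)
          hyps(11,12,14) hyps(15-19)])
  next
    case False
    \<comment> \<open>The sample may be empty, but the claimed probability is not positive.\<close>
    hence "m = 1" using hyps(1-3) by linarith
    hence "1 - 2 * real k / real m ^ 2 \<le> 0" using hyps(2) by simp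
    thus ?thesis using measure_nonneg order_trans by blast
  qed
qed simp

end
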